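(* Let $\sigma$ be either $\leq$ or $<$. For every positive rational number $\lambda$ there is an integer $n_0=n_0(\lambda,\sigma)\geq 1$ such that, for every integer $m\geq 1$, \[ R_{n_0+m}^{\sigma}(\lambda)=R_{n_0}^{\sigma}(\lambda)+R_m^{\sigma}\bigl(\lambda-R_{n_0}^{\sigma}(\lambda)\bigr), \] and the greedy $m$-term denominator tuple of $\lambda-R_{n_0}^{\sigma}(\lambda)$ is the unique maximizing $m$-term denominator tuple for $R_m^{\sigma}\bigl(\lambda-R_{n_0}^{\sigma}(\lambda)\bigr)$. Moreover, one can choose a maximizing denominator tuple $(a_1,\ldots,a_{n_0})$ for $R_{n_0}^{\sigma}(\lambda)$ such that, for every $m\geq 1$, adjoining the first $m$ greedy denominators $g_1,\ldots,g_m$ of $\lambda-R_{n_0}^{\sigma}(\lambda)$ produces a maximizing tuple $(a_1,\ldots,a_{n_0},g_1,\ldots,g_m)$ for $R_{n_0+m}^{\sigma}(\lambda)$.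
   Context: $\mathbb{N}=\{1,2,\ldots\}$. For $n\geq 1$ let $\mathcal{E}_n^{\leq}=\{(a_1,\ldots,a_n)\in\mathbb{N}^n: 2\leq a_1\leq\cdots\leq a_n\}$ and $\mathcal{E}_n^{<}=\{(a_1,\ldots,a_n)\in\mathbb{N}^n: 2\leq a_1<\cdots<a_n\}$. For a real $\mu>0$ and $\sigma\in\{\leq,<\}$ define \[ R_n^{\sigma}(\mu)=\max\Bigl\{\sum_{i=1}^n\frac1{a_i}:\ (a_1,\ldots,a_n)\in\mathcal{E}_n^{\sigma},\ \sum_{i=1}^n\frac1{a_i}<\mu\Bigr\} \] (the maximum is known to exist). A tuple in $\mathcal{E}_n^{\sigma}$ attaining this maximum is called a maximizing $n$-term denominator tuple for $R_n^\sigma(\mu)$. Greedy algorithm: the greedy denominators $g_1,g_2,\ldots$ of $\mu>0$ under the convention $\sigma$ are defined recursively: $g_1$ is the smallest integer $x\geq 2$ with $1/x<\mu$, and $g_{i+1}$ is the smallest integer $x\geq 2$ with $x\geq g_i$ (if $\sigma$ is $\leq$), respectively $x>g_i$ (if $\sigma$ is $<$), for which $1/x<\mu-\sum_{j=1}^{i}1/g_j$. The greedy $m$-term denominator tuple of $\mu$ is $(g_1,\ldots,g_m)$. *)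

theory Defs
  imports Complex_Main
begin

text \<open>
  The convention is a relation \<open>\<sigma>\<close> on \<open>nat\<close>, intended to be either \<open>(\<le>)\<close> or \<open>(<)\<close>.
  Tuples are lists.
\<close>

definition denom_tuples :: "(nat \<Rightarrow> nat \<Rightarrow> bool) \<Rightarrow> nat \<Rightarrow> nat list set" where
  "denom_tuples \<sigma> n = {as. length as = n \<and> (\<forall>a\<in>set as. 2 \<le> a) \<and> sorted_wrt \<sigma> as}"

definition recip_sum :: "nat list \<Rightarrow> real" where
  "recip_sum as = (\<Sum>a\<leftarrow>as. 1 / real a)"

definition admissible :: "(nat \<Rightarrow> nat \<Rightarrow> bool) \<Rightarrow> nat \<Rightarrow> real \<Rightarrow> nat list \<Rightarrow> bool" where
  "admissible \<sigma> n \<mu> as \<longleftrightarrow> as \<in> denom_tuples \<sigma> n \<and> recip_sum as < \<mu>"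

text \<open>
  The set of candidate sums is infinite in general, so \<open>Max\<close> (specified for finite sets only)
  cannot be used here; \<open>GREATEST\<close> denotes the maximum whenever it exists.
\<close>

definition R :: "(nat \<Rightarrow> nat \<Rightarrow> bool) \<Rightarrow> nat \<Rightarrow> real \<Rightarrow> real" where
  "R \<sigma> n \<mu> = (GREATEST s. \<exists>as. admissible \<sigma> n \<mu> as \<and> s = recip_sum as)"

definition maximizing :: "(nat \<Rightarrow> nat \<Rightarrow> bool) \<Rightarrow> nat \<Rightarrow> real \<Rightarrow> nat list \<Rightarrow> bool" where
  "maximizing \<sigma> n \<mu> as \<longleftrightarrow> is_arg_max recip_sum (admissible \<sigma> n \<mu>) as"

fun greedy :: "(nat \<Rightarrow> nat \<Rightarrow> bool) \<Rightarrow> real \<Rightarrow> nat \<Rightarrow> nat list" where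
  "greedy \<sigma> \<mu> 0 = []"
| "greedy \<sigma> \<mu> (Suc m) =
     (let gs = greedy \<sigma> \<mu> m
      in gs @ [LEAST x. 2 \<le> x \<and> (gs \<noteq> [] \<longrightarrow> \<sigma> (last gs) x) \<and> 1 / real x < \<mu> - recip_sum gs])"

end

theory Submission
  imports Defs
begin

text \<open>
  Let \<open>D\<^sub>n = l - R\<^sub>n(l)\<close> and \<open>y\<^sub>i = D\<^sub>i - D\<^sub>i\<^sub>+\<^sub>1\<close>, and let \<open>q\<close> be a denominator of \<open>l\<close>.  Comparing an
  optimal tuple \<open>a\<close> with the (in general non-unit) increments \<open>y\<^sub>i\<close> by Abel summation shows that the
  product of the \<open>t\<^sub>i = y\<^sub>i a\<^sub>i\<close> is at most \<open>1\<close>.  As \<open>D\<^sub>n q \<Prod>a\<^sub>i\<close> is a positive integer, this gives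
  \<open>E\<^sub>n = q D\<^sub>n / \<Prod>y\<^sub>i \<ge> 1\<close>.  On the other hand one greedy step shows \<open>E\<^sub>n\<^sub>+\<^sub>1 \<le> E\<^sub>n\<close> for large \<open>n\<close>.
  So \<open>E\<close> converges, which means \<open>D\<^sub>n\<^sub>+\<^sub>1 / D\<^sub>n\<^sup>2 \<longlonglongrightarrow> 1\<close>, and the total defect of the comparison is
  bounded independently of \<open>n\<close>.  Hence a long optimal tuple has late positions with arbitrarily
  small defect, and integrality of the numerators makes the remainder there a unit fraction
  \<open>1/N\<close>.  From \<open>1/N\<close> on, Soundararajan's argument for Sylvester's sequence shows that the
  greedy continuation is the unique optimal one.
\<close>

section \<open>Abel summation and integrality of numerators\<close>

text \<open>Since \<open>y i * b i - 1 = (y i - 1 / b i) * b i\<close>, this is summation by parts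
  with weights \<open>b\<close>. It serves where the partial sums of \<open>y i - 1 / b i\<close>
  have known sign and \<open>b\<close> is monotone.\<close>

lemma abel_summation_recip:
  fixes y b :: "nat \<Rightarrow> real"
  assumes "\<And>i. i < Suc m \<Longrightarrow> b i \<noteq> 0"
  shows "(\<Sum>i<Suc m. y i * b i - 1) =
    (\<Sum>i<Suc m. y i - 1 / b i) * b m - (\<Sum>k<m. (\<Sum>i<Suc k. y i - 1 / b i) * (b (Suc k) - b k))"
  using assms
proof (induction m)
  case 0
  then show ?case by (simp add: field_simps)
next
  case (Suc m)
  have b: "b (Suc m) \<noteq> 0" using Suc.prems by simp
  define d where "d = (\<Sum>i<Suc m. y i - 1 / b i)"
  define s where "s = (\<Sum>k<m. (\<Sum>i<Suc k. y i - 1 / b i) * (b (Suc k) - b k))"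
  have "(\<Sum>i<Suc m. y i * b i - 1) = d * b m - s"
    using Suc unfolding d_def s_def by simp
  moreover have "(y (Suc m) - 1 / b (Suc m)) * b (Suc m) = y (Suc m) * b (Suc m) - 1"
    using b by (simp add: field_simps)
  moreover have "(\<Sum>k<Suc m. (\<Sum>i<Suc k. y i - 1 / b i) * (b (Suc k) - b k))
      = s + d * (b (Suc m) - b m)"
    unfolding d_def s_def by (simp only: sum.lessThan_Suc)
  ultimately show ?case
    unfolding sum.lessThan_Suc[of _ "Suc m"] d_def[symmetric]
    by (simp add: algebra_simps)
qed

text \<open>\<open>q\<close> clears the denominator of \<open>l\<close>, and each further factor
  \<open>b k\<close> clears that of the newly subtracted \<open>1 / b k\<close>.\<close>

lemma remainder_times_prod_Ints:
  fixes l q :: real and b :: "nat \<Rightarrow> nat"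
  assumes "q * l \<in> \<int>" "q \<in> \<int>" "\<And>i. i < k \<Longrightarrow> 0 < b i"
  shows "(l - (\<Sum>i<k. 1 / real (b i))) * (q * (\<Prod>i<k. real (b i))) \<in> \<int>"
  using assms(3)
proof (induction k)
  case 0
  then show ?case using assms by (simp add: mult.commute)
next
  case (Suc k)
  define Q where "Q = q * (\<Prod>i<k. real (b i))"
  have "Q \<in> \<int>" unfolding Q_def using assms(2) by (intro Ints_mult Ints_prod) auto
  moreover have "(l - (\<Sum>i<k. 1 / real (b i))) * Q \<in> \<int>" unfolding Q_def using Suc by simp
  ultimately have "(l - (\<Sum>i<k. 1 / real (b i))) * Q * real (b k) - Q \<in> \<int>"
    by (metis Ints_diff Ints_mult Ints_of_nat)
  moreover have "(l - (\<Sum>i<Suc k. 1 / real (b i))) * (q * (\<Prod>i<Suc k. real (b i)))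
     = (l - (\<Sum>i<k. 1 / real (b i))) * Q * real (b k) - Q"
    using Suc.prems[of k] unfolding Q_def by (simp add: field_simps)
  ultimately show ?case by simp
qed

lemma pos_Ints_ge_1:
  fixes x :: real
  assumes "x \<in> \<int>" "0 < x"
  shows "1 \<le> x"
  using assms by (auto elim!: Ints_cases)

section \<open>The Sylvester sequence\<close>

text \<open>Reciprocals of the remainders in the greedy expansion of \<open>1 / N\<close>, by
  \<open>1 / s - 1 / (s + 1) = 1 / (s * (s + 1))\<close>. The denominators are
  \<open>sylvester N i + 1\<close>; for \<open>N = 1\<close> they begin 2, 3, 7, 43.\<close>

primrec sylvester :: "nat \<Rightarrow> nat \<Rightarrow> nat" where
  "sylvester N 0 = N"
| "sylvester N (Suc i) = sylvester N i * (sylvester N i + 1)"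

lemma sylvester_pos [simp]: "0 < N \<Longrightarrow> 0 < sylvester N i"
  by (induction i) auto

lemma sum_recip_sylvester:
  assumes "0 < N"
  shows "(\<Sum>i<m. 1 / real (sylvester N i + 1)) = 1 / real N - 1 / real (sylvester N m)"
proof (induction m)
  case (Suc m)
  have "0 < real (sylvester N m)" using assms by simp
  then have "1 / real (sylvester N (Suc m)) = 1 / real (sylvester N m) - 1 / real (sylvester N m + 1)"
    by (simp add: field_simps)
  then show ?case using Suc by simp
qed simp

lemma prod_sylvester: "real N * (\<Prod>i<m. real (sylvester N i + 1)) = real (sylvester N m)"
  by (induction m) (simp_all add: algebra_simps)

text \<open>
  The induction hypothesis says that no prefix of \<open>b\<close> beats the corresponding prefix of the
  Sylvester sequence, so Abel summation gives \<open>\<Sum>(t\<^sub>i - 1) \<le> 0\<close> for the quotients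
  \<open>t\<^sub>i\<close> of the two sequences.  On the other hand \<open>\<Prod>t\<^sub>i \<ge> 1\<close>, because the remainder of \<open>b\<close>
  is a positive multiple of \<open>1 / (N * \<Prod>b\<^sub>i)\<close>.
\<close>

lemma sylvester_unique_best:
  fixes b :: "nat \<Rightarrow> nat"
  assumes "0 < N"
    and "\<And>i j. i \<le> j \<Longrightarrow> j < m \<Longrightarrow> b i \<le> b j"
    and "\<And>i. i < m \<Longrightarrow> 0 < b i"
    and "(\<Sum>i<m. 1 / real (b i)) < 1 / real N"
    and "1 / real N - 1 / real (sylvester N m) \<le> (\<Sum>i<m. 1 / real (b i))"
    and "i < m"
  shows "b i = sylvester N i + 1"
  using assms(2-)
proof (induction m arbitrary: i rule: less_induct)
  case (less m)
  define y where "y i = 1 / real (sylvester N i + 1)" for i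
  define t where "t i = y i * real (b i)" for i
  note pos = less.prems(2)
  \<comment> \<open>A prefix with larger sum would satisfy the hypotheses for \<open>k\<close>, so
    the induction hypothesis would identify it with the Sylvester prefix and the sums would
    agree.\<close>
  have prefix: "(\<Sum>i<k. 1 / real (b i)) \<le> (\<Sum>i<k. y i)" if k: "k < m" for k
  proof (rule ccontr)
    assume *: "\<not> (\<Sum>i<k. 1 / real (b i)) \<le> (\<Sum>i<k. y i)"
    have "(\<Sum>i<k. 1 / real (b i)) \<le> (\<Sum>i<m. 1 / real (b i))"
      using k by (intro sum_mono2) auto
    then have "b i = sylvester N i + 1" if "i < k" for i
      using less.IH[OF k, of i] less.prems(1,2,3) * that k
      unfolding y_def sum_recip_sylvester[OF \<open>0 < N\<close>] by force
    then have "(\<Sum>i<k. 1 / real (b i)) = (\<Sum>i<k. y i)"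
      unfolding y_def by (intro sum.cong) auto
    with * show False by simp
  qed
  obtain m' where m': "m = Suc m'" using less.prems(5) by (cases m) auto
  have "(\<Sum>i<m. t i - 1) = (\<Sum>i<m. y i - 1 / real (b i)) * real (b m')
      - (\<Sum>k<m'. (\<Sum>i<Suc k. y i - 1 / real (b i)) * (real (b (Suc k)) - real (b k)))"
    unfolding t_def m' by (rule abel_summation_recip) (use pos m' in force)
  moreover have "0 \<le> (\<Sum>k<m'. (\<Sum>i<Suc k. y i - 1 / real (b i)) * (real (b (Suc k)) - real (b k)))"
  proof (rule sum_nonneg, rule mult_nonneg_nonneg)
    show "0 \<le> (\<Sum>i<Suc k. y i - 1 / real (b i))" if "k \<in> {..<m'}" for k
      using prefix[of "Suc k"] that unfolding m' sum_subtractf by simp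
    show "0 \<le> real (b (Suc k)) - real (b k)" if "k \<in> {..<m'}" for k
      using less.prems(1)[of k "Suc k"] that m' by simp
  qed
  moreover have "(\<Sum>i<m. y i - 1 / real (b i)) * real (b m') \<le> 0"
    using less.prems(4) by (intro mult_nonpos_nonneg)
      (auto simp: sum_subtractf y_def sum_recip_sylvester[OF \<open>0 < N\<close>, simplified])
  ultimately have sum: "(\<Sum>i<m. t i - 1) \<le> 0" by linarith
  have tpos: "0 < t i" if "i < m" for i
    using pos that unfolding t_def y_def by simp
  define e where "e = 1 / real N - (\<Sum>i<m. 1 / real (b i))"
  define B where "B = real N * (\<Prod>i<m. real (b i))"
  have B: "0 < B" unfolding B_def using pos \<open>0 < N\<close> by (intro mult_pos_pos prod_pos) auto
  have e: "0 < e" "e \<le> 1 / real (sylvester N m)" using less.prems unfolding e_def by auto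
  have "e * B \<in> \<int>" unfolding e_def B_def
    by (rule remainder_times_prod_Ints) (use \<open>0 < N\<close> pos in auto)
  then have "1 \<le> e * B" using e B by (intro pos_Ints_ge_1) auto
  also have "\<dots> \<le> 1 / real (sylvester N m) * B" using e B by (intro mult_right_mono) auto
  also have "\<dots> = (\<Prod>i<m. t i)"
    unfolding t_def y_def B_def prod_sylvester[symmetric] using \<open>0 < N\<close>
    by (simp add: prod_dividef)
  finally have "0 \<le> ln (\<Prod>i<m. t i)" by simp
  also have "\<dots> = (\<Sum>i<m. ln (t i))"
    using tpos by (intro ln_prod) force+
  finally have "(\<Sum>i<m. t i - 1 - ln (t i)) \<le> 0"
    using sum by (simp add: sum_subtractf)
  moreover have nn: "0 \<le> t i - 1 - ln (t i)" if "i < m" for i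
    using ln_le_minus_one[OF tpos[OF that]] by simp
  \<comment> \<open>Nonnegative terms with sum at most \<open>0\<close> all vanish, and
    \<open>ln x = x - 1\<close> holds only at \<open>x = 1\<close>.\<close>
  ultimately have "(\<Sum>i<m. t i - 1 - ln (t i)) = 0"
    by (intro antisym sum_nonneg) auto
  then have "t i - 1 - ln (t i) = 0"
    using nn less.prems(5) sum_nonneg_eq_0_iff[of "{..<m}" "\<lambda>i. t i - 1 - ln (t i)"] by auto
  then have "t i = 1" using tpos less.prems(5) by (intro ln_eq_minus_one) auto
  then have "real (b i) = real (sylvester N i + 1)" unfolding t_def y_def by (simp add: field_simps)
  then show ?case by (simp only: of_nat_eq_iff)
qed

section \<open>Existence of the maximum\<close>

lemma recip_sum_Nil [simp]: "recip_sum [] = 0"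
  and recip_sum_Cons [simp]: "recip_sum (a # as) = 1 / real a + recip_sum as"
  and recip_sum_append [simp]: "recip_sum (as @ bs) = recip_sum as + recip_sum bs"
  by (simp_all add: recip_sum_def)

lemma recip_sum_nonneg: "0 \<le> recip_sum as"
  by (induction as) auto

lemma recip_sum_conv_nth: "recip_sum as = (\<Sum>i<length as. 1 / real (as ! i))"
  by (simp add: recip_sum_def sum_list_sum_nth atLeast0LessThan)

lemma recip_sum_take: "k \<le> length as \<Longrightarrow> recip_sum (take k as) = (\<Sum>i<k. 1 / real (as ! i))"
  by (simp add: recip_sum_conv_nth)

lemma recip_sum_sort: "recip_sum (sort as) = recip_sum as"
proof -
  have "recip_sum (insort a as) = 1 / real a + recip_sum as" for a as
    by (induction as) auto
  then show ?thesis by (induction as) auto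
qed

lemma recip_sum_le_length_div:
  assumes "\<And>a. a \<in> set as \<Longrightarrow> h \<le> a" "0 < h"
  shows "recip_sum as \<le> real (length as) / real h"
  using assms(1)
proof (induction as)
  case (Cons a as)
  then have "h \<le> a" by simp
  then have "1 / real a \<le> 1 / real h" using assms(2) by (intro divide_left_mono mult_pos_pos) auto
  then show ?case using Cons by (simp add: add_divide_distrib)
qed simp

text \<open>
  For tuples whose sum is at least \<open>s > 0\<close> the smallest entry is at most \<open>n / s\<close>, so only
  finitely many first entries compete.
\<close>

lemma ex_max_recip_sum:
  assumes "T \<noteq> {}" "\<And>as. as \<in> T \<Longrightarrow> length as = n \<and> sorted as \<and> (\<forall>a\<in>set as. 0 < a)"
  shows "\<exists>as\<in>T. \<forall>bs\<in>T. recip_sum bs \<le> recip_sum as"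
  using assms
proof (induction n arbitrary: T)
  case 0
  then show ?case by (metis ex_in_conv length_0_conv order_refl)
next
  case (Suc n)
  obtain c where c: "c \<in> T" using Suc.prems by auto
  define s where "s = recip_sum c"
  have "0 < s" unfolding s_def using Suc.prems(2)[OF c]
    by (cases c) (auto intro!: add_pos_nonneg recip_sum_nonneg)
  define T' where "T' = {as \<in> T. s \<le> recip_sum as}"
  have cT': "c \<in> T'" using c by (simp add: T'_def s_def)
  have hd_le: "hd as \<le> nat \<lfloor>real (Suc n) / s\<rfloor>" if "as \<in> T'" for as
  proof -
    have as: "length as = Suc n" "sorted as" "\<forall>a\<in>set as. 0 < a" "s \<le> recip_sum as"
      using that Suc.prems(2) by (auto simp: T'_def)
    then have "hd as \<in> set as" "\<And>a. a \<in> set as \<Longrightarrow> hd as \<le> a"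
      by (cases as; auto)+
    then have "recip_sum as \<le> real (Suc n) / real (hd as)" and "0 < hd as"
      using recip_sum_le_length_div[of as "hd as"] as by auto
    then have "real (hd as) \<le> real (Suc n) / s"
      using as \<open>0 < s\<close> by (simp add: field_simps) (smt (verit) mult_left_mono of_nat_0_le_iff mult.commute)
    then show ?thesis by (simp add: le_nat_floor)
  qed
  have fin: "finite (hd ` T')"
    by (rule finite_subset[of _ "{..nat \<lfloor>real (Suc n) / s\<rfloor>}"]) (use hd_le in auto)
  have "\<exists>as\<in>T'. hd as = h \<and> (\<forall>bs\<in>T'. hd bs = h \<longrightarrow> recip_sum bs \<le> recip_sum as)"
    if "h \<in> hd ` T'" for h
  proof -
    have split: "as = hd as # tl as" if "as \<in> T'" for as
      using that Suc.prems(2)[of as] by (cases as) (auto simp: T'_def)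
    have "\<exists>as\<in>tl ` {as \<in> T'. hd as = h}. \<forall>bs\<in>tl ` {as \<in> T'. hd as = h}. recip_sum bs \<le> recip_sum as"
    proof (rule Suc.IH)
      show "tl ` {as \<in> T'. hd as = h} \<noteq> {}" using that by auto
      fix as assume "as \<in> tl ` {as \<in> T'. hd as = h}"
      then obtain cs where "cs \<in> T" "as = tl cs" by (auto simp: T'_def)
      then show "length as = n \<and> sorted as \<and> (\<forall>a\<in>set as. 0 < a)"
        using Suc.prems(2)[of cs] by (cases cs) auto
    qed
    then obtain as where as: "as \<in> T'" "hd as = h"
      and le: "\<And>bs. bs \<in> T' \<Longrightarrow> hd bs = h \<Longrightarrow> recip_sum (tl bs) \<le> recip_sum (tl as)"
      by auto
    have "recip_sum bs \<le> recip_sum as" if "bs \<in> T'" "hd bs = h" for bs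
      using le[OF that] split[OF that(1)] split[OF as(1)] that(2) as(2)
      by (metis add_left_mono recip_sum_Cons)
    with as show ?thesis by blast
  qed
  then obtain F where F: "\<And>h. h \<in> hd ` T' \<Longrightarrow> F h \<in> T'"
    "\<And>as. as \<in> T' \<Longrightarrow> recip_sum as \<le> recip_sum (F (hd as))"
    by (metis imageI)
  define mx where "mx = Max ((\<lambda>h. recip_sum (F h)) ` hd ` T')"
  have "mx \<in> (\<lambda>h. recip_sum (F h)) ` hd ` T'"
    unfolding mx_def using fin cT' by (intro Max_in) auto
  then obtain h where h: "h \<in> hd ` T'" "recip_sum (F h) = mx" by auto
  have "recip_sum as \<le> recip_sum (F h)" if "as \<in> T" for as
  proof (cases "as \<in> T'")
    case True
    then have "recip_sum (F (hd as)) \<le> mx" unfolding mx_def using fin by (intro Max_ge) auto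
    then show ?thesis using F(2)[OF True] h by linarith
  next
    case False
    then show ?thesis using that F(1)[OF h(1)] by (auto simp: T'_def)
  qed
  moreover have "F h \<in> T" using F(1)[OF h(1)] by (simp add: T'_def)
  ultimately show ?case by blast
qed

text \<open>Telescoping of \<open>ln (1 + 1 / (M + i)) \<le> 1 / (M + i)\<close>: a quantitative
  divergence of the harmonic series, for runs of consecutive denominators.\<close>

lemma ln_le_sum_recip:
  assumes "0 < M"
  shows "ln (real (M + k) / real M) \<le> (\<Sum>i<k. 1 / real (M + i))"
proof (induction k)
  case (Suc k)
  have "ln (real (M + Suc k) / real M) = ln (real (M + k) / real M) + ln (1 + 1 / real (M + k))"
  proof -
    have "real (M + Suc k) / real M = real (M + k) / real M * (1 + 1 / real (M + k))"
      using assms by (simp add: divide_simps)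
    moreover have "0 < real (M + k) / real M" "0 < 1 + 1 / real (M + k)"
      using assms by (auto intro!: divide_pos_pos add_pos_nonneg)
    ultimately show ?thesis by (simp only: ln_mult_pos)
  qed
  moreover have "ln (1 + 1 / real (M + k)) \<le> 1 / real (M + k)"
    by (rule ln_add_one_self_le_self) simp
  ultimately show ?case using Suc by simp
qed (use assms in simp)

locale convention =
  fixes \<sigma> :: "nat \<Rightarrow> nat \<Rightarrow> bool"
  assumes sigma: "\<sigma> = (\<le>) \<or> \<sigma> = (<)"
begin

lemma denom_tuplesD:
  assumes "as \<in> denom_tuples \<sigma> n"
  shows "length as = n" "\<And>a. a \<in> set as \<Longrightarrow> 2 \<le> a" "sorted_wrt \<sigma> as" "sorted as"
    "\<sigma> = (<) \<Longrightarrow> distinct as"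
proof -
  show "length as = n" "\<And>a. a \<in> set as \<Longrightarrow> 2 \<le> a" and s: "sorted_wrt \<sigma> as"
    using assms by (auto simp: denom_tuples_def)
  show "sorted as" by (rule sorted_wrt_mono_rel[OF _ s]) (use sigma in auto)
  show "\<sigma> = (<) \<Longrightarrow> distinct as" using s strict_sorted_iff by auto
qed

lemma sort_in_denom_tuples:
  assumes "\<And>a. a \<in> set as \<Longrightarrow> 2 \<le> a" "\<sigma> = (<) \<Longrightarrow> distinct as"
  shows "sort as \<in> denom_tuples \<sigma> (length as)"
  using sigma assms by (auto simp: denom_tuples_def strict_sorted_iff)

lemma maximizing_iff:
  "maximizing \<sigma> n \<mu> as \<longleftrightarrow>
    admissible \<sigma> n \<mu> as \<and> (\<forall>bs. admissible \<sigma> n \<mu> bs \<longrightarrow> recip_sum bs \<le> recip_sum as)"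
  by (simp add: maximizing_def is_arg_max_linorder)

lemma R_eq_recip_sum: "maximizing \<sigma> n \<mu> as \<Longrightarrow> R \<sigma> n \<mu> = recip_sum as"
  unfolding maximizing_iff R_def by (intro Greatest_equality) auto

lemma ex_maximizing:
  assumes "0 < \<mu>"
  shows "\<exists>as. maximizing \<sigma> n \<mu> as"
proof -
  define T where "T = {as. admissible \<sigma> n \<mu> as}"
  \<comment> \<open>As \<open>k > n / \<mu>\<close>, any \<open>n\<close> entries from
    \<open>k\<close> on have sum below \<open>\<mu>\<close>; consecutive ones are admissible under
    both conventions.\<close>
  define k where "k = nat \<lfloor>real n / \<mu>\<rfloor> + 2"
  have "real n / \<mu> < real k" unfolding k_def using assms by (simp add: of_nat_nat) linarith
  moreover have "2 \<le> k" by (simp add: k_def)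
  ultimately have "real n / real k < \<mu>" using assms by (simp add: field_simps)
  moreover have "recip_sum [k..<k+n] \<le> real (length [k..<k+n]) / real k"
    by (rule recip_sum_le_length_div) (use \<open>2 \<le> k\<close> in auto)
  ultimately have "recip_sum [k..<k+n] < \<mu>" by simp
  moreover have "[k..<k+n] \<in> denom_tuples \<sigma> n"
    using sort_in_denom_tuples[of "[k..<k+n]"] \<open>2 \<le> k\<close> by simp
  ultimately have "T \<noteq> {}" unfolding T_def admissible_def by blast
  moreover have "length as = n \<and> sorted as \<and> (\<forall>a\<in>set as. 0 < a)" if "as \<in> T" for as
    using that denom_tuplesD[of as n] unfolding T_def admissible_def by force
  ultimately show ?thesis
    using ex_max_recip_sum[of T n] unfolding T_def maximizing_iff by auto
qed

section \<open>Greedy expansion of unit fractions\<close>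

lemma recip_sum_sylvester:
  assumes "0 < N"
  shows "recip_sum (map (\<lambda>i. sylvester N i + 1) [0..<m]) = 1 / real N - 1 / real (sylvester N m)"
  using sum_recip_sylvester[OF assms, of m] by (simp add: recip_sum_conv_nth)

text \<open>From remainder \<open>1 / s\<close> the least \<open>x\<close> with
  \<open>1 / x < 1 / s\<close> is \<open>s + 1\<close>. It exceeds the previous denominator, so both
  conventions make the same choice.\<close>

lemma greedy_eq_sylvester:
  assumes "0 < N"
  shows "greedy \<sigma> (1 / real N) m = map (\<lambda>i. sylvester N i + 1) [0..<m]"
proof (induction m)
  case (Suc m)
  let ?gs = "map (\<lambda>i. sylvester N i + 1) [0..<m]" and ?s = "sylvester N m"
  have s: "0 < ?s" using assms by simp
  have "\<sigma> (last ?gs) (?s + 1)" if ne: "?gs \<noteq> []"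
  proof -
    obtain m' where m': "m = Suc m'" using ne by (cases m) auto
    have "sylvester N m' + 1 \<le> ?s" using assms by (simp add: m' Suc_le_eq)
    then show ?thesis using sigma m' by auto
  qed
  then have "(LEAST x. 2 \<le> x \<and> (?gs \<noteq> [] \<longrightarrow> \<sigma> (last ?gs) x) \<and> 1 / real x < 1 / real ?s) = ?s + 1"
  proof (intro Least_equality)
    show "?s + 1 \<le> x"
      if "2 \<le> x \<and> (?gs \<noteq> [] \<longrightarrow> \<sigma> (last ?gs) x) \<and> 1 / real x < 1 / real ?s" for x
    proof -
      have "real ?s < real x" using that s by (simp add: divide_less_eq split: if_splits)
      then show ?thesis by simp
    qed
  qed (use s in \<open>auto simp: field_simps\<close>)
  then show ?case
    using Suc recip_sum_sylvester[OF assms, of m] by (simp add: Let_def)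
qed simp

lemma sylvester_in_denom_tuples:
  assumes "0 < N"
  shows "greedy \<sigma> (1 / real N) m \<in> denom_tuples \<sigma> m"
proof -
  have "strict_mono (sylvester N)"
    using assms by (auto simp: strict_mono_Suc_iff)
  then have "sorted_wrt (<) (map (\<lambda>i. sylvester N i + 1) [0..<m])"
    by (simp add: sorted_wrt_iff_nth_less strict_mono_less)
  then have "sorted_wrt \<sigma> (map (\<lambda>i. sylvester N i + 1) [0..<m])"
    by (rule sorted_wrt_mono_rel[rotated]) (use sigma in auto)
  then show ?thesis
    unfolding greedy_eq_sylvester[OF assms] denom_tuples_def
    using assms by (auto simp: Suc_le_eq)
qed

text \<open>List form of \<open>sylvester_unique_best\<close>, applied both to competitors of the
  greedy tuple and to tails of optimal tuples.\<close>

lemma sylvester_le_imp_eq: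
  assumes "0 < N" "sorted as" "\<And>a. a \<in> set as \<Longrightarrow> 0 < a" "length as = m"
    and "recip_sum as < 1 / real N" "1 / real N - 1 / real (sylvester N m) \<le> recip_sum as"
  shows "as = greedy \<sigma> (1 / real N) m"
proof -
  have "as ! i = sylvester N i + 1" if "i < m" for i
  proof (rule sylvester_unique_best[OF assms(1) _ _ _ _ that])
    show "as ! i \<le> as ! j" if "i \<le> j" "j < m" for i j
      using assms(2,4) that by (intro sorted_nth_mono) auto
    show "0 < as ! i" if "i < m" for i using assms(3,4) that by simp
  qed (use assms(4-6) in \<open>simp_all add: recip_sum_conv_nth\<close>)
  then show ?thesis
    unfolding greedy_eq_sylvester[OF assms(1)] using assms(4) by (intro nth_equalityI) auto
qed

lemma greedy_unique_maximizing:
  assumes "0 < N"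
  shows "maximizing \<sigma> m (1 / real N) (greedy \<sigma> (1 / real N) m)"
    and "maximizing \<sigma> m (1 / real N) bs \<Longrightarrow> bs = greedy \<sigma> (1 / real N) m"
    and "R \<sigma> m (1 / real N) = 1 / real N - 1 / real (sylvester N m)"
proof -
  let ?g = "greedy \<sigma> (1 / real N) m"
  have s: "recip_sum ?g = 1 / real N - 1 / real (sylvester N m)"
    using greedy_eq_sylvester[OF assms] recip_sum_sylvester[OF assms] by simp
  have adm: "admissible \<sigma> m (1 / real N) ?g"
    using sylvester_in_denom_tuples[OF assms] s assms by (simp add: admissible_def)
  have eq: "bs = ?g" if "admissible \<sigma> m (1 / real N) bs" "recip_sum ?g \<le> recip_sum bs" for bs
  proof -
    have "bs \<in> denom_tuples \<sigma> m" "recip_sum bs < 1 / real N"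
      using that(1) by (simp_all add: admissible_def)
    note bs = denom_tuplesD[OF this(1)] this(2)
    have "0 < a" if "a \<in> set bs" for a using bs(2)[OF that] by simp
    then show ?thesis using bs that(2) assms s by (intro sylvester_le_imp_eq) simp_all
  qed
  show max: "maximizing \<sigma> m (1 / real N) ?g"
    unfolding maximizing_iff using adm eq by (metis linear order_refl)
  show "maximizing \<sigma> m (1 / real N) bs \<Longrightarrow> bs = ?g"
    using adm eq unfolding maximizing_iff by blast
  show "R \<sigma> m (1 / real N) = 1 / real N - 1 / real (sylvester N m)"
    using R_eq_recip_sum[OF max] s by simp
qed

end

section \<open>The optimal remainders\<close>

locale underapproximation = convention +
  fixes l :: real
  assumes l_pos: "0 < l"
begin

definition D :: "nat \<Rightarrow> real" where
  "D n = l - R \<sigma> n l"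

lemma maximizing_D: "maximizing \<sigma> n l as \<Longrightarrow> D n = l - recip_sum as"
  by (simp add: D_def R_eq_recip_sum)

lemma D_pos: "0 < D n"
  using ex_maximizing[OF l_pos, of n] maximizing_D[of n] by (auto simp: maximizing_iff admissible_def)

lemma maximizing_iff_D:
  "maximizing \<sigma> n l as \<longleftrightarrow> as \<in> denom_tuples \<sigma> n \<and> l - recip_sum as = D n"
proof -
  obtain bs where bs: "maximizing \<sigma> n l bs" using ex_maximizing[OF l_pos] by blast
  note D = maximizing_D[OF this]
  show ?thesis
  proof
    assume "maximizing \<sigma> n l as"
    then show "as \<in> denom_tuples \<sigma> n \<and> l - recip_sum as = D n"
      using maximizing_D[of n as] by (simp add: maximizing_iff admissible_def)
  next
    assume *: "as \<in> denom_tuples \<sigma> n \<and> l - recip_sum as = D n"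
    then have "recip_sum as < l" "recip_sum as = recip_sum bs" using D D_pos[of n] by linarith+
    then show "maximizing \<sigma> n l as"
      using bs * by (simp add: maximizing_iff admissible_def)
  qed
qed

lemma D_0: "D 0 = l"
proof -
  have "maximizing \<sigma> 0 l []"
    using l_pos by (auto simp: maximizing_iff admissible_def denom_tuples_def)
  then show ?thesis by (simp add: maximizing_D)
qed

text \<open>Sorting preserves the sum, so competitors may be listed in any order; entries can then
  be adjoined or exchanged freely.\<close>

lemma D_le:
  assumes "\<And>a. a \<in> set as \<Longrightarrow> 2 \<le> a" "\<sigma> = (<) \<Longrightarrow> distinct as" "recip_sum as < l"
  shows "D (length as) \<le> l - recip_sum as"
proof -
  obtain bs where bs: "maximizing \<sigma> (length as) l bs" using ex_maximizing[OF l_pos] by blast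
  have "admissible \<sigma> (length as) l (sort as)"
    using sort_in_denom_tuples[OF assms(1,2)] assms(3) by (simp add: admissible_def recip_sum_sort)
  then have "recip_sum (sort as) \<le> recip_sum bs" using bs by (simp add: maximizing_iff)
  then show ?thesis using maximizing_D[OF bs] by (simp add: recip_sum_sort)
qed

lemma D_Suc_le:
  assumes "maximizing \<sigma> n l as" "2 \<le> x" "\<sigma> = (<) \<Longrightarrow> x \<notin> set as" "1 / real x < D n"
  shows "D (Suc n) \<le> D n - 1 / real x"
proof -
  have "as \<in> denom_tuples \<sigma> n" using assms(1) by (simp add: maximizing_iff_D)
  note as = denom_tuplesD[OF this]
  have "D (length (x # as)) \<le> l - recip_sum (x # as)"
  proof (rule D_le)
    show "2 \<le> a" if "a \<in> set (x # as)" for a using that as(2) assms(2) by auto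
    show "distinct (x # as)" if "\<sigma> = (<)" using as(5)[OF that] assms(3)[OF that] by simp
    show "recip_sum (x # as) < l" using assms(4) maximizing_D[OF assms(1)] by simp
  qed
  then show ?thesis using as(1) maximizing_D[OF assms(1)] by simp
qed

lemma D_Suc_less: "D (Suc n) < D n"
proof -
  obtain as where as: "maximizing \<sigma> n l as" using ex_maximizing[OF l_pos] by blast
  \<comment> \<open>Larger than \<open>1 / D n\<close>, than 2 and than every entry, so
    \<open>x\<close> can be adjoined under both conventions.\<close>
  define x where "x = nat \<lfloor>1 / D n\<rfloor> + Max (insert 2 (set as)) + 1"
  have ge: "w \<le> Max (insert 2 (set as))" if "w \<in> insert 2 (set as)" for w
    by (intro Max_ge) (use that in auto)
  have "1 / D n < real x" unfolding x_def using D_pos[of n] by simp linarith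
  moreover have x0: "0 < x" by (simp add: x_def)
  ultimately have "1 / real x < D n" using D_pos[of n] by (simp add: field_simps)
  moreover have "Max (insert 2 (set as)) < x" unfolding x_def by linarith
  then have "2 \<le> x" "x \<notin> set as" using ge[of 2] ge[of x] by auto
  ultimately have "D (Suc n) \<le> D n - 1 / real x" by (intro D_Suc_le[OF as]) auto
  moreover have "0 < 1 / real x" using x0 by simp
  ultimately show ?thesis by linarith
qed

lemma D_mono: "m \<le> n \<Longrightarrow> D n \<le> D m"
  using D_Suc_less by (intro decseqD[of D]) (auto simp: decseq_Suc_iff less_imp_le)

text \<open>Take the denominators \<open>M, M + 1, ...\<close> and stop just before their sum
  reaches \<open>l\<close>. The next reciprocal would close the gap, so the remainder is at most
  \<open>1 / M < e\<close>.\<close>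

lemma ex_D_less:
  assumes "0 < e"
  shows "\<exists>n. D n < e"
proof -
  define M where "M = nat \<lfloor>1 / e\<rfloor> + 2"
  have "1 / e < real M" unfolding M_def using assms by simp linarith
  moreover have "2 \<le> M" by (simp add: M_def)
  ultimately have M: "1 / real M < e" "2 \<le> M" using assms by (simp_all add: field_simps)
  define S where "S k = (\<Sum>i<k. 1 / real (M + i))" for k
  have "\<exists>k. l \<le> S k"
  proof -
    define k where "k = nat \<lceil>exp l * real M\<rceil>"
    have "exp l * real M \<le> real (M + k)" unfolding k_def by simp linarith
    then have "exp l \<le> real (M + k) / real M" using M by (simp add: field_simps)
    then have "l \<le> ln (real (M + k) / real M)"
      using M by (subst ln_ge_iff) (auto intro!: divide_pos_pos)
    also have "\<dots> \<le> S k" unfolding S_def by (rule ln_le_sum_recip) (use M in auto)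
    finally show ?thesis by blast
  qed
  then have L: "l \<le> S (LEAST k. l \<le> S k)" by (rule LeastI_ex)
  then have "(LEAST k. l \<le> S k) \<noteq> 0" using l_pos by (intro notI) (simp add: S_def)
  then obtain k where k: "(LEAST k. l \<le> S k) = Suc k" using not0_implies_Suc by blast
  have "S k < l" using not_less_Least[of k "\<lambda>k. l \<le> S k"] k by simp
  moreover have "recip_sum [M..<M+k] = S k" by (simp add: S_def recip_sum_conv_nth)
  ultimately have "D (length [M..<M+k]) \<le> l - S k"
    using D_le[of "[M..<M+k]"] M by simp
  also have "\<dots> \<le> 1 / real (M + k)" using L k by (simp add: S_def)
  also have "\<dots> \<le> 1 / real M" using M by (intro divide_left_mono) auto
  also have "\<dots> < e" by (rule M)
  finally show ?thesis by blast
qed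

lemma D_tendsto_0: "D \<longlonglongrightarrow> 0"
proof (rule LIMSEQ_I)
  fix r :: real assume "0 < r"
  then obtain n where "D n < r" using ex_D_less by blast
  then have "norm (D m - 0) < r" if "n \<le> m" for m
    using D_mono[OF that] D_pos[of m] by simp
  then show "\<exists>n. \<forall>m\<ge>n. norm (D m - 0) < r" by blast
qed

text \<open>
  The denominator \<open>y = \<lfloor>1/D\<^sub>n\<rfloor> + 1\<close> chosen by the greedy algorithm may only fail to be available
  when \<open>\<sigma>\<close> is \<open><\<close> and \<open>y\<close> already occurs.  Then let \<open>z + 1, \<dots>, y\<close> be the maximal run of
  consecutive entries ending in \<open>y\<close>.  Its reciprocal sum is less than \<open>l\<close>, so the run is
  short and replacing \<open>z + 1\<close> by \<open>z\<close> would improve the tuple.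
\<close>

lemma greedy_step:
  "\<exists>d>0. \<forall>n. D n < d \<longrightarrow> D (Suc n) \<le> D n * (D n - D (Suc n))"
proof -
  define Y where "Y = max 1 (exp l * (exp l + 1))"
  have Y: "1 \<le> Y" by (simp add: Y_def)
  \<comment> \<open>Such a run has reciprocal sum at least
    \<open>ln ((y + 1) / (z + 1)) \<ge> l\<close>. For \<open>z \<ge> exp l\<close> this follows
    from \<open>z * (z + 1) \<le> y\<close>; smaller \<open>z\<close> are covered by
    \<open>Y\<close>.\<close>
  have long: "l \<le> (\<Sum>i\<in>{z<..y}. 1 / real i)" if "1 \<le> z" "z < y" "z * (z + 1) \<le> y" "Y \<le> real y" for y z
  proof -
    have "exp l * (real z + 1) \<le> real y + 1"
    proof (cases "exp l \<le> real z")
      case True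
      then have "exp l * (real z + 1) \<le> real z * (real z + 1)" by (intro mult_right_mono) auto
      also have "\<dots> = real (z * (z + 1))" by (simp add: algebra_simps)
      also have "\<dots> \<le> real y" using that(3) by (simp only: of_nat_le_iff)
      finally show ?thesis by simp
    next
      case False
      then have "exp l * (real z + 1) \<le> exp l * (exp l + 1)" by (intro mult_left_mono) auto
      then show ?thesis using that(4) unfolding Y_def by linarith
    qed
    then have "exp l \<le> real ((z + 1) + (y - z)) / real (z + 1)"
      using \<open>z < y\<close> by (simp add: field_simps of_nat_diff)
    then have "l \<le> ln (real ((z + 1) + (y - z)) / real (z + 1))"
      by (subst ln_ge_iff) (auto intro!: divide_pos_pos)
    also have "\<dots> \<le> (\<Sum>i<y - z. 1 / real ((z + 1) + i))" by (rule ln_le_sum_recip) simp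
    also have "\<dots> = (\<Sum>i\<in>{z<..y}. 1 / real i)"
      by (rule sum.reindex_bij_witness[of _ "\<lambda>i. i - (z + 1)" "\<lambda>i. z + 1 + i"]) (use \<open>z < y\<close> in auto)
    finally show ?thesis .
  qed
  have "D (Suc n) \<le> D n * (D n - D (Suc n))" if n: "D n < 1 / Y" for n
  proof -
    define y where "y = nat \<lfloor>1 / D n\<rfloor> + 1"
    have "real y \<le> 1 / D n + 1" "1 / D n < real y"
      unfolding y_def using D_pos[of n] by (simp_all, linarith+)
    moreover have "Y < 1 / D n" using n D_pos[of n] Y by (simp add: field_simps)
    ultimately have y: "real y \<le> 1 / D n + 1" "1 / D n < real y" "Y < real y" by auto
    then have y2: "2 \<le> y" using Y by linarith
    have yD: "1 / real y < D n" using y(2) D_pos[of n] y2 by (simp add: field_simps)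
    obtain as where max: "maximizing \<sigma> n l as" using ex_maximizing[OF l_pos] by blast
    then have as: "as \<in> denom_tuples \<sigma> n" "l - recip_sum as = D n" by (simp_all add: maximizing_iff_D)
    note dt = denom_tuplesD[OF as(1)]
    have "y \<notin> set as" if "\<sigma> = (<)"
    proof
      assume "y \<in> set as"
      have dist: "distinct as" using dt(5) that by blast
      \<comment> \<open>The element \<open>1\<close> guarantees that the maximum exists;
        \<open>z = 1\<close> is excluded below, since \<open>y < z * (z + 1)\<close> would then
        contradict \<open>2 \<le> y\<close>.\<close>
      define Z where "Z = {z. 1 \<le> z \<and> z < y \<and> (z = 1 \<or> z \<notin> set as)}"
      define z where "z = Max Z"
      have Z: "finite Z" "1 \<in> Z" using y2 by (auto simp: Z_def)
      have "z \<in> Z" unfolding z_def by (rule Max_in) (use Z in auto)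
      have run: "{z<..y} \<subseteq> set as"
      proof
        fix w assume "w \<in> {z<..y}"
        then have "w \<notin> Z" unfolding z_def using Max_ge[OF Z(1), of w] by auto
        moreover have "1 \<le> z" using \<open>z \<in> Z\<close> by (simp add: Z_def)
        ultimately show "w \<in> set as"
          using \<open>w \<in> {z<..y}\<close> \<open>y \<in> set as\<close> by (cases "w = y") (auto simp: Z_def)
      qed
      have "(\<Sum>i\<in>{z<..y}. 1 / real i) \<le> (\<Sum>i\<in>set as. 1 / real i)"
        by (rule sum_mono2) (use run in auto)
      also have "\<dots> = recip_sum as"
        using dist by (simp add: recip_sum_def sum_list_distinct_conv_sum_set)
      also have "\<dots> < l" using as D_pos[of n] by linarith
      finally have zz: "y < z * (z + 1)" using long[of z y] \<open>z \<in> Z\<close> y by (force simp: Z_def)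
      with y2 have z2: "z \<noteq> 1" by auto
      then have z: "2 \<le> z" "z \<notin> set as" "z + 1 \<in> set as" using \<open>z \<in> Z\<close> run by (auto simp: Z_def)
      define bs where "bs = z # remove1 (z + 1) as"
      have len: "length bs = n" using z dt(1) unfolding bs_def
        by (simp add: length_remove1) (metis Suc_pred length_pos_if_in_set)
      have "recip_sum as = 1 / real (z + 1) + recip_sum (remove1 (z + 1) as)"
        unfolding recip_sum_def using z by (intro sum_list_map_remove1) auto
      then have "recip_sum bs = recip_sum as + (1 / real z - 1 / real (z + 1))"
        unfolding bs_def by simp
      also have "1 / real z - 1 / real (z + 1) = 1 / real (z * (z + 1))"
        using z by (simp add: field_simps)
      finally have s: "recip_sum bs = recip_sum as + 1 / real (z * (z + 1))" .
      \<comment> \<open>The gain \<open>1 / (z * (z + 1))\<close> is below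
        \<open>1 / y < D n\<close>, so the exchanged tuple still has sum less than
        \<open>l\<close>.\<close>
      have "real y < real (z * (z + 1))" using zz by (simp only: of_nat_less_iff)
      then have "1 / real (z * (z + 1)) < 1 / real y" using y2 by (intro divide_strict_left_mono) auto
      then have "recip_sum bs < l" using s yD as by linarith
      then have "D (length bs) \<le> l - recip_sum bs"
        using z dt(2) dist by (intro D_le) (auto simp: bs_def dest: notin_set_remove1 set_remove1_subset[THEN subsetD])
      then have "1 / real (z * (z + 1)) \<le> 0" unfolding len using s as(2) by linarith
      moreover have "0 < z * (z + 1)" using z(1) by simp
      then have "0 < 1 / real (z * (z + 1))" by (simp only: of_nat_0_less_iff zero_less_divide_1_iff)
      ultimately show False by linarith
    qed
    then have "D (Suc n) \<le> D n - 1 / real y" by (intro D_Suc_le[OF max y2 _ yD])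
    \<comment> \<open>Bounding \<open>y\<close> by \<open>1 / D n + 1\<close> leaves at most
      \<open>(D n)\<^sup>2 / (1 + D n)\<close> as remainder, which rearranges to the claim.\<close>
    moreover have "1 / (1 / D n + 1) \<le> 1 / real y"
      using y(1) y2 D_pos[of n] by (intro divide_left_mono mult_pos_pos add_pos_pos) auto
    moreover have "1 / (1 / D n + 1) = D n / (1 + D n)" using D_pos[of n] by (simp add: field_simps)
    ultimately have "D (Suc n) \<le> D n - D n / (1 + D n)" by linarith
    also have "\<dots> = D n * D n / (1 + D n)" using D_pos[of n] by (simp add: field_simps)
    finally have "D (Suc n) * (1 + D n) \<le> D n * D n"
      using D_pos[of n] by (simp add: pos_le_divide_eq)
    then show ?thesis by (simp add: algebra_simps)
  qed
  moreover have "0 < 1 / Y" using Y by simp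
  ultimately show ?thesis by blast
qed

end

text \<open>Applying \<open>ln x \<le> x - 1\<close> to \<open>x = sqrt (t x)\<close> gives the
  lower bound \<open>(sqrt (t x) - 1)\<^sup>2\<close> for the defect.\<close>

lemma tendsto_1_if_minus_ln_tendsto_0:
  fixes t :: "'a \<Rightarrow> real"
  assumes "((\<lambda>x. t x - 1 - ln (t x)) \<longlongrightarrow> 0) F" "\<And>x. 0 < t x"
  shows "(t \<longlongrightarrow> 1) F"
proof -
  have le: "(sqrt (t x) - 1)\<^sup>2 \<le> t x - 1 - ln (t x)" for x
  proof -
    have "ln (t x) = 2 * ln (sqrt (t x))" using assms(2)[of x] by (simp add: ln_sqrt)
    moreover have "ln (sqrt (t x)) \<le> sqrt (t x) - 1" using assms(2)[of x] by (intro ln_le_minus_one) simp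
    moreover have "(sqrt (t x) - 1)\<^sup>2 = t x - 2 * sqrt (t x) + 1"
      using assms(2)[of x] by (simp add: power2_eq_square algebra_simps)
    ultimately show ?thesis by linarith
  qed
  have "((\<lambda>x. (sqrt (t x) - 1)\<^sup>2) \<longlongrightarrow> 0) F"
    by (rule tendsto_sandwich[OF _ _ tendsto_const assms(1)]) (use le in auto)
  then have "((\<lambda>x. sqrt ((sqrt (t x) - 1)\<^sup>2)) \<longlongrightarrow> sqrt 0) F" by (rule tendsto_real_sqrt)
  then have "((\<lambda>x. sqrt (t x) - 1) \<longlongrightarrow> 0) F" by (simp add: tendsto_rabs_zero_iff)
  then have "((\<lambda>x. (sqrt (t x) - 1 + 1)\<^sup>2) \<longlongrightarrow> (0 + 1)\<^sup>2) F" by (intro tendsto_intros)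
  then show ?thesis using assms(2) by (simp add: less_imp_le)
qed

lemma sum_shift_le:
  fixes f :: "nat \<Rightarrow> real"
  assumes "c \<le> d" "\<And>i. i < p + d \<Longrightarrow> 0 \<le> f i"
  shows "(\<Sum>k<p. f (k + c)) \<le> (\<Sum>i<p + d. f i)"
proof -
  have "(\<Sum>k<p. f (k + c)) = sum f ((\<lambda>k. k + c) ` {..<p})" by (simp add: sum.reindex)
  also have "\<dots> \<le> (\<Sum>i<p + d. f i)" by (rule sum_mono2) (use assms in auto)
  finally show ?thesis .
qed

context convention
begin

lemma append_greedy_in_denom_tuples:
  assumes "as \<in> denom_tuples \<sigma> k" "0 < N" "\<And>a. a \<in> set as \<Longrightarrow> \<sigma> a (N + 1)"
  shows "as @ greedy \<sigma> (1 / real N) m \<in> denom_tuples \<sigma> (k + m)"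
proof -
  have "N \<le> sylvester N i" for i by (induction i) (auto intro: trans_le_add1)
  then have "\<sigma> a b" if "a \<in> set as" "b \<in> set (greedy \<sigma> (1 / real N) m)" for a b
    using that assms(3)[OF that(1)] sigma unfolding greedy_eq_sylvester[OF assms(2)]
    by (auto intro: le_trans less_le_trans)
  then show ?thesis
    using assms(1) sylvester_in_denom_tuples[OF assms(2), of m]
    by (auto simp: denom_tuples_def sorted_wrt_append)
qed

end

section \<open>Comparing optimal tuples with the optimal increments\<close>

locale rational_underapproximation = underapproximation +
  fixes q :: nat
  assumes q_pos: "0 < q" and q_l: "real q * l \<in> \<int>"
begin

definition y :: "nat \<Rightarrow> real" where
  "y n = D n - D (Suc n)"

text \<open>The numerator of the optimal remainder with each denominator replaced by its ideal real
  value \<open>1 / y i\<close>.\<close>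

definition E :: "nat \<Rightarrow> real" where
  "E n = D n * real q / (\<Prod>i<n. y i)"

definition eps :: "nat list \<Rightarrow> nat \<Rightarrow> real" where
  "eps as k = l - recip_sum (take k as)"

definition t :: "nat list \<Rightarrow> nat \<Rightarrow> real" where
  "t as i = y i * real (as ! i)"

text \<open>The unreduced numerator of the remainder over the common denominator \<open>q\<close>
  times the product of the entries.\<close>

definition numer :: "nat list \<Rightarrow> nat \<Rightarrow> real" where
  "numer as k = eps as k * (real q * (\<Prod>i<k. real (as ! i)))"

text \<open>The terms of the Abel sum; they measure, besides the \<open>t\<close>, how far a tuple
  is from the ideal one.\<close>

definition S :: "nat list \<Rightarrow> nat \<Rightarrow> real" where
  "S as j = (eps as (Suc j) - D (Suc j)) * (real (as ! Suc j) - real (as ! j))"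

lemma y_pos: "0 < y n"
  using D_Suc_less by (simp add: y_def)

lemma sum_y: "(\<Sum>i<k. y i) = l - D k"
  by (induction k) (simp_all add: D_0 y_def)

lemma E_pos: "0 < E n"
  unfolding E_def using D_pos y_pos q_pos by (intro divide_pos_pos mult_pos_pos prod_pos) auto

lemma E_Suc: "E (Suc n) = E n * (D (Suc n) / (D n * y n))"
  unfolding E_def using D_pos[of n] by (simp add: field_simps)

context
  fixes n as
  assumes max: "maximizing \<sigma> n l as"
begin

lemma max_tuple: "as \<in> denom_tuples \<sigma> n" "length as = n" "l - recip_sum as = D n"
  using max denom_tuplesD(1) by (auto simp: maximizing_iff_D)

lemma max_nth_ge_2: "i < n \<Longrightarrow> 2 \<le> as ! i"
  using denom_tuplesD(2)[OF max_tuple(1)] max_tuple(2) by auto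

lemma max_nth_pos: "i < n \<Longrightarrow> 0 < as ! i"
  using max_nth_ge_2[of i] by simp

lemma max_nth_mono: "i \<le> j \<Longrightarrow> j < n \<Longrightarrow> as ! i \<le> as ! j"
  using denom_tuplesD(4)[OF max_tuple(1)] max_tuple(2) by (simp add: sorted_nth_mono)

lemma take_in_denom_tuples: "k \<le> n \<Longrightarrow> take k as \<in> denom_tuples \<sigma> k"
  using max_tuple by (auto simp: denom_tuples_def sorted_wrt_take dest: in_set_takeD)

lemma eps_n: "eps as n = D n"
  using max_tuple by (simp add: eps_def)

lemma eps_Suc: "k < n \<Longrightarrow> eps as (Suc k) = eps as k - 1 / real (as ! k)"
  using max_tuple(2) by (simp add: eps_def take_Suc_conv_app_nth)

text \<open>A prefix of an optimal tuple is itself a competitor for its own length.\<close>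

lemma D_le_eps:
  assumes "k \<le> n"
  shows "D k \<le> eps as k"
proof -
  have "recip_sum as = recip_sum (take k as) + recip_sum (drop k as)"
    by (metis append_take_drop_id recip_sum_append)
  then have "recip_sum (take k as) < l"
    using recip_sum_nonneg[of "drop k as"] max_tuple(3) D_pos[of n] by linarith
  note dt = denom_tuplesD[OF take_in_denom_tuples[OF assms]]
  have "D (length (take k as)) \<le> l - recip_sum (take k as)"
    using \<open>recip_sum (take k as) < l\<close> by (intro D_le dt(2,5))
  then show ?thesis unfolding eps_def dt(1) .
qed

lemma eps_pos: "k \<le> n \<Longrightarrow> 0 < eps as k"
  using D_le_eps D_pos by (meson less_le_trans)

lemma t_pos: "i < n \<Longrightarrow> 0 < t as i"
  using max_nth_ge_2[of i] y_pos[of i] by (simp add: t_def)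

lemma S_nonneg: "Suc j < n \<Longrightarrow> 0 \<le> S as j"
  using D_le_eps[of "Suc j"] max_nth_mono[of j "Suc j"] by (simp add: S_def)

lemma sum_y_minus_recip: "k \<le> n \<Longrightarrow> (\<Sum>i<k. y i - 1 / real (as ! i)) = eps as k - D k"
  using max_tuple(2) by (simp add: sum_subtractf sum_y eps_def recip_sum_take)

lemma sum_t:
  assumes "k < n"
  shows "(\<Sum>i<Suc k. t as i - 1) = (eps as (Suc k) - D (Suc k)) * real (as ! k) - (\<Sum>j<k. S as j)"
proof -
  have "(\<Sum>i<Suc k. t as i - 1) = (\<Sum>i<Suc k. y i - 1 / real (as ! i)) * real (as ! k) -
      (\<Sum>j<k. (\<Sum>i<Suc j. y i - 1 / real (as ! i)) * (real (as ! Suc j) - real (as ! j)))"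
    unfolding t_def
  proof (rule abel_summation_recip)
    show "real (as ! i) \<noteq> 0" if "i < Suc k" for i using max_nth_pos[of i] that assms by simp
  qed
  also have "(\<Sum>j<k. (\<Sum>i<Suc j. y i - 1 / real (as ! i)) * (real (as ! Suc j) - real (as ! j)))
      = (\<Sum>j<k. S as j)"
    unfolding S_def using assms by (intro sum.cong refl) (subst sum_y_minus_recip, auto)
  finally show ?thesis using assms by (subst (asm) sum_y_minus_recip) auto
qed

lemma numer_Ints:
  assumes "k \<le> n"
  shows "numer as k \<in> \<int>"
proof -
  have "(l - (\<Sum>i<k. 1 / real (as ! i))) * (real q * (\<Prod>i<k. real (as ! i))) \<in> \<int>"
    by (rule remainder_times_prod_Ints[OF q_l]) (use max_nth_pos assms in auto)
  then show ?thesis using assms max_tuple(2) by (simp add: numer_def eps_def recip_sum_take)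
qed

lemma numer_ge_1:
  assumes "k \<le> n"
  shows "1 \<le> numer as k"
proof (rule pos_Ints_ge_1[OF numer_Ints[OF assms]])
  show "0 < numer as k"
    unfolding numer_def using max_nth_pos assms eps_pos[OF assms] q_pos
    by (intro mult_pos_pos prod_pos) auto
qed

text \<open>If two consecutive numerators agree, this recurrence makes the remainder the unit
  fraction \<open>1 / (as ! k - 1)\<close>.\<close>

lemma numer_Suc:
  assumes "k < n"
  shows "numer as (Suc k) = numer as k * real (as ! k) - real q * (\<Prod>i<k. real (as ! i))"
  using max_nth_ge_2[OF assms] unfolding numer_def eps_Suc[OF assms]
  by (simp add: field_simps)

lemma numer_eq: "numer as k = eps as k / D k * E k * (\<Prod>i<k. t as i)"
proof -
  have "(\<Prod>i<k. y i) \<noteq> 0" using y_pos by (simp add: less_imp_neq[symmetric])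
  then show ?thesis
    using D_pos[of k] by (simp add: numer_def E_def t_def prod.distrib)
qed

lemma ln_prod_t:
  assumes "k \<le> n"
  shows "ln (\<Prod>i<k. t as i) = (\<Sum>i<k. ln (t as i))"
proof (rule ln_prod)
  show "t as i \<noteq> 0" if "i \<in> {..<k}" for i using t_pos[of i] that assms by simp
qed simp

lemma prod_t_pos: "k \<le> n \<Longrightarrow> 0 < (\<Prod>i<k. t as i)"
  using t_pos by (intro prod_pos) auto

text \<open>Take logarithms, use \<open>ln x \<le> x - 1\<close>, and drop the nonnegative terms
  \<open>S\<close> in \<open>sum_t\<close>.\<close>

lemma prod_t_le:
  assumes "k < n"
  shows "(\<Prod>i<Suc k. t as i) \<le> exp ((eps as (Suc k) - D (Suc k)) * real (as ! k))"
proof -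
  have "ln (\<Prod>i<Suc k. t as i) = (\<Sum>i<Suc k. ln (t as i))" using assms by (intro ln_prod_t) simp
  also have "\<dots> \<le> (\<Sum>i<Suc k. t as i - 1)"
    by (intro sum_mono ln_le_minus_one t_pos) (use assms in auto)
  also have "\<dots> \<le> (eps as (Suc k) - D (Suc k)) * real (as ! k)"
  proof -
    have "0 \<le> (\<Sum>j<k. S as j)" by (intro sum_nonneg S_nonneg) (use assms in auto)
    then show ?thesis unfolding sum_t[OF assms] by simp
  qed
  finally show ?thesis using prod_t_pos[of "Suc k"] assms by (metis Suc_leI exp_le_cancel_iff exp_ln)
qed

text \<open>At full length \<open>eps as n = D n\<close>, so the boundary term of
  \<open>sum_t\<close> vanishes. Integrality of the numerator gives
  \<open>E n * (\<Prod>i<n. t as i) \<ge> 1\<close>, whose logarithm bounds the total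
  defect.\<close>

lemma cost_le:
  assumes "n = Suc k"
  shows "(\<Sum>i<n. t as i - 1 - ln (t as i)) + (\<Sum>j<k. S as j) \<le> ln (E n)" and "1 \<le> E n"
proof -
  have num: "1 \<le> E n * (\<Prod>i<n. t as i)"
    using numer_ge_1[of n] numer_eq[of n] D_pos[of n] by (simp add: eps_n)
  then have "0 \<le> ln (E n * (\<Prod>i<n. t as i))" by simp
  also have "\<dots> = ln (E n) + (\<Sum>i<n. ln (t as i))"
    using E_pos prod_t_pos[of n] ln_prod_t[of n] by (simp add: ln_mult_pos)
  finally show "(\<Sum>i<n. t as i - 1 - ln (t as i)) + (\<Sum>j<k. S as j) \<le> ln (E n)"
    using sum_t[of k] assms eps_n by (simp add: sum_subtractf)
  have "(\<Prod>i<n. t as i) \<le> 1" using prod_t_le[of k] assms eps_n by simp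
  then have "E n * (\<Prod>i<n. t as i) \<le> E n * 1" using E_pos[of n] by (intro mult_left_mono) auto
  with num show "1 \<le> E n" by linarith
qed

end

section \<open>Asymptotics of the optimal remainders\<close>

lemma E_ge_1: "1 \<le> E (Suc n)"
  using ex_maximizing[OF l_pos, of "Suc n"] cost_le(2) by blast

lemma eventually_greedy_step: "\<forall>\<^sub>F n in sequentially. D (Suc n) \<le> D n * y n"
proof -
  obtain d where "0 < d" "\<And>n. D n < d \<Longrightarrow> D (Suc n) \<le> D n * (D n - D (Suc n))"
    using greedy_step by blast
  then show ?thesis
    using order_tendstoD(2)[OF D_tendsto_0 \<open>0 < d\<close>] by (auto simp: y_def elim: eventually_mono)
qed

lemma E_convergent: obtains L where "E \<longlonglongrightarrow> L" "1 \<le> L"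
proof -
  obtain n1 where n1: "\<And>n. n1 \<le> n \<Longrightarrow> D (Suc n) \<le> D n * y n"
    using eventually_greedy_step by (auto simp: eventually_sequentially)
  have "E (Suc n) \<le> E n" if "n1 \<le> n" for n
  proof -
    have "D (Suc n) / (D n * y n) \<le> 1"
      using n1[OF that] D_pos[of n] y_pos[of n] by (simp add: divide_le_eq_1)
    then have "E n * (D (Suc n) / (D n * y n)) \<le> E n * 1"
      using E_pos[of n] by (intro mult_left_mono) auto
    then show ?thesis by (simp add: E_Suc)
  qed
  \<comment> \<open>The shift by \<open>Suc n1\<close> gives monotonicity and lets
    \<open>E_ge_1\<close>, which speaks of successors, apply.\<close>
  then have "decseq (\<lambda>n. E (n + Suc n1))" by (simp add: decseq_Suc_iff)
  moreover have "\<forall>n. 1 \<le> E (n + Suc n1)" using E_ge_1 by simp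
  ultimately obtain L where L: "(\<lambda>n. E (n + Suc n1)) \<longlonglongrightarrow> L"
    using decseq_convergent by blast
  have "1 \<le> L" by (rule LIMSEQ_le_const[OF L]) (use E_ge_1 in auto)
  then show thesis using that LIMSEQ_offset[OF L] by blast
qed

lemma D_quotient_tendsto_0: "(\<lambda>n. D (Suc n) / D n) \<longlonglongrightarrow> 0"
proof (rule tendsto_sandwich[OF _ _ tendsto_const D_tendsto_0])
  show "\<forall>\<^sub>F n in sequentially. 0 \<le> D (Suc n) / D n"
    using D_pos by (simp add: less_imp_le)
  show "\<forall>\<^sub>F n in sequentially. D (Suc n) / D n \<le> D n"
    using eventually_greedy_step
  proof eventually_elim
    case (elim n)
    also have "D n * y n \<le> D n * D n"
      using D_pos[of n] D_pos[of "Suc n"] by (intro mult_left_mono) (auto simp: y_def)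
    finally show ?case using D_pos[of n] by (simp add: divide_le_eq)
  qed
qed

lemma y_quotient_tendsto_1: "(\<lambda>n. y n / D n) \<longlonglongrightarrow> 1"
proof -
  have "(\<lambda>n. 1 - D (Suc n) / D n) \<longlonglongrightarrow> 1 - 0"
    by (intro tendsto_intros D_quotient_tendsto_0)
  moreover have "1 - D (Suc n) / D n = y n / D n" for n
    using D_pos[of n] by (simp add: y_def field_simps)
  ultimately show ?thesis by simp
qed

text \<open>\<open>E (Suc n) / E n\<close> is \<open>D (Suc n) / (D n * y n)\<close>; it tends to
  \<open>1\<close> because the limit of \<open>E\<close> is nonzero, and \<open>y n\<close> is
  asymptotic to \<open>D n\<close>.\<close>

lemma D_square_quotient_tendsto_1: "(\<lambda>n. D (Suc n) / (D n)\<^sup>2) \<longlonglongrightarrow> 1"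
proof -
  obtain L where L: "E \<longlonglongrightarrow> L" "1 \<le> L" by (rule E_convergent)
  then have "(\<lambda>n. E (Suc n) / E n * (y n / D n)) \<longlonglongrightarrow> L / L * 1"
    by (intro tendsto_intros LIMSEQ_Suc y_quotient_tendsto_1) auto
  moreover have "E (Suc n) / E n * (y n / D n) = D (Suc n) / (D n)\<^sup>2" for n
    using E_pos[of n] D_pos[of n] y_pos[of n] unfolding E_Suc by (simp add: field_simps power2_eq_square)
  ultimately show ?thesis using L by simp
qed

text \<open>The defect around position \<open>k\<close>. This window controls the entries
  \<open>k\<close> to \<open>k + 2\<close> and the remainders at \<open>k + 1\<close> and
  \<open>k + 2\<close>, whose numerators are compared later.\<close>

definition cost :: "nat list \<Rightarrow> nat \<Rightarrow> real" where
  "cost as k = (t as k - 1 - ln (t as k)) + (t as (k + 1) - 1 - ln (t as (k + 1)))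
     + (t as (k + 2) - 1 - ln (t as (k + 2))) + S as k + S as (k + 1)"

lemma ex_cheap_index:
  assumes "0 < e"
  shows "\<exists>n2. \<forall>n\<ge>n2. \<forall>as. maximizing \<sigma> n l as \<longrightarrow> (\<exists>k\<ge>K. k + 2 < n \<and> cost as k < e)"
proof -
  obtain L where L: "E \<longlonglongrightarrow> L" "1 \<le> L" by (rule E_convergent)
  have "\<forall>\<^sub>F n in sequentially. E n < L + 1" using L by (intro order_tendstoD(2)[OF L(1)]) simp
  then obtain n1 where n1: "\<And>n. n1 \<le> n \<Longrightarrow> E n < L + 1" by (auto simp: eventually_sequentially)
  define C where "C = ln (L + 1)"
  \<comment> \<open>Each of the five parts of \<open>cost\<close>, summed over all positions, is at
    most \<open>C\<close>. From length \<open>n2\<close> on, more than \<open>5 * C / e\<close>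
    positions are available beyond \<open>K\<close>.\<close>
  define n2 where "n2 = max n1 (K + 3 + nat \<lceil>5 * C / e\<rceil>)"
  have "\<exists>k\<ge>K. k + 2 < n \<and> cost as k < e" if n: "n2 \<le> n" and max: "maximizing \<sigma> n l as" for n as
  proof (rule ccontr)
    assume "\<not> ?thesis"
    then have ge: "e \<le> cost as k" if "K \<le> k" "k + 2 < n" for k
      using that by (auto simp: not_less)
    have "2 \<le> n" using n by (simp add: n2_def)
    then obtain p where p: "n = p + 2" using le_Suc_ex by (metis add.commute)
    define f where "f i = t as i - 1 - ln (t as i)" for i
    have f: "0 \<le> f i" if "i < n" for i
      using ln_le_minus_one[OF t_pos[OF max that]] by (simp add: f_def)
    have S: "0 \<le> S as j" if "j < p + 1" for j using S_nonneg[OF max] that p by simp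
    have ln: "(\<Sum>i<p+2. f i) + (\<Sum>j<p+1. S as j) \<le> C"
    proof -
      have "ln (E n) \<le> C" unfolding C_def using n1[of n] n E_pos[of n] L by (simp add: n2_def)
      then show ?thesis using cost_le(1)[OF max, of "p + 1"] p unfolding f_def by simp
    qed
    have "real (p - K) * e = (\<Sum>k\<in>{K..<p}. e)" by simp
    also have "\<dots> \<le> (\<Sum>k\<in>{K..<p}. cost as k)" by (intro sum_mono ge) (auto simp: p)
    also have "\<dots> \<le> (\<Sum>k<p. cost as k)"
      by (rule sum_mono2) (auto simp: p cost_def f_def[symmetric] intro!: add_nonneg_nonneg f S)
    also have "\<dots> = (\<Sum>k<p. f (k + 0)) + (\<Sum>k<p. f (k + 1)) + (\<Sum>k<p. f (k + 2))
        + (\<Sum>k<p. S as (k + 0)) + (\<Sum>k<p. S as (k + 1))"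
      unfolding cost_def f_def[symmetric] by (simp add: sum.distrib)
    also have "\<dots> \<le> (\<Sum>i<p+2. f i) + (\<Sum>i<p+2. f i) + (\<Sum>i<p+2. f i)
        + (\<Sum>j<p+1. S as j) + (\<Sum>j<p+1. S as j)"
      by (intro add_mono sum_shift_le f S) (auto simp: p)
    also have "\<dots> \<le> 5 * C"
    proof -
      have "0 \<le> (\<Sum>i<p+2. f i)" "0 \<le> (\<Sum>j<p+1. S as j)"
        by (intro sum_nonneg f S; auto simp: p)+
      then show ?thesis using ln by linarith
    qed
    finally have "real (p - K) \<le> 5 * C / e" using assms by (simp add: field_simps)
    moreover have "K + 1 + nat \<lceil>5 * C / e\<rceil> \<le> p" using n p unfolding n2_def by simp
    then have "real (K + 1 + nat \<lceil>5 * C / e\<rceil>) \<le> real p" by (simp only: of_nat_le_iff)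
    ultimately show False by (simp add: of_nat_diff) linarith
  qed
  then show ?thesis by blast
qed

section \<open>Unit fraction remainders\<close>

lemma cost_bounds:
  assumes "maximizing \<sigma> n l as" "k + 2 < n"
  shows "i \<in> {k, k + 1, k + 2} \<Longrightarrow> 0 \<le> t as i - 1 - ln (t as i) \<and> t as i - 1 - ln (t as i) \<le> cost as k"
    and "i \<in> {k, k + 1} \<Longrightarrow> 0 \<le> S as i \<and> S as i \<le> cost as k"
proof -
  have f: "0 \<le> t as i - 1 - ln (t as i)" if "i < n" for i
    using ln_le_minus_one[OF t_pos[OF assms(1) that]] by simp
  have S: "0 \<le> S as i" if "Suc i < n" for i using S_nonneg[OF assms(1) that] .
  show "0 \<le> t as i - 1 - ln (t as i) \<and> t as i - 1 - ln (t as i) \<le> cost as k" if "i \<in> {k, k + 1, k + 2}"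
    using that f[of k] f[of "k + 1"] f[of "k + 2"] S[of k] S[of "k + 1"] assms(2)
    unfolding cost_def by auto
  show "0 \<le> S as i \<and> S as i \<le> cost as k" if "i \<in> {k, k + 1}"
    using that f[of k] f[of "k + 1"] f[of "k + 2"] S[of k] S[of "k + 1"] assms(2)
    unfolding cost_def by auto
qed

text \<open>
  Along indices \<open>k \<longlongrightarrow> \<infinity>\<close> whose \<open>cost\<close> tends to \<open>0\<close>, the entries satisfy \<open>a\<^sub>k D\<^sub>k \<longrightarrow> 1\<close>, so the remainders
  \<open>\<epsilon>\<^sub>k\<close> are asymptotically optimal, and the integer numerators of two consecutive remainders are
  bounded with quotient tending to \<open>1\<close>.  Hence they are eventually equal, which forces the
  remainder to be the unit fraction \<open>1 / (a\<^sub>k - 1)\<close>.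
\<close>

lemma eventually_unit_fraction_remainder:
  "\<exists>n2. \<forall>n\<ge>n2. \<forall>as. maximizing \<sigma> n l as \<longrightarrow> (\<exists>k<n. eps as k * (real (as ! k) - 1) = 1)"
proof (rule ccontr)
  assume neg: "\<not> ?thesis"
  \<comment> \<open>Failure of the claim gives for every \<open>j\<close> a counterexample with
    index at least \<open>j\<close> and cost below \<open>1 / (j + 1)\<close>; limits are taken
    along this sequence.\<close>
  define Q where "Q j n as k \<longleftrightarrow> maximizing \<sigma> n l as \<and> j \<le> k \<and> k + 2 < n \<and>
      cost as k < 1 / real (Suc j) \<and> (\<forall>i<n. eps as i * (real (as ! i) - 1) \<noteq> 1)" for j n as k
  have "\<exists>n as k. Q j n as k" for j
  proof -
    obtain n2 where n2: "\<And>n as. n2 \<le> n \<Longrightarrow> maximizing \<sigma> n l as \<Longrightarrow>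
        \<exists>k\<ge>j. k + 2 < n \<and> cost as k < 1 / real (Suc j)"
      using ex_cheap_index[of "1 / real (Suc j)" j] by auto
    obtain n as where "n2 \<le> n" "maximizing \<sigma> n l as" "\<forall>k<n. eps as k * (real (as ! k) - 1) \<noteq> 1"
      using neg by blast
    then show ?thesis using n2 unfolding Q_def by blast
  qed
  then obtain n A k where Q: "\<And>j. Q j (n j) (A j) (k j)" by metis
  then have
    max: "\<And>j. maximizing \<sigma> (n j) l (A j)" and
    jk: "\<And>j. j \<le> k j" and kn: "\<And>j. k j + 2 < n j" and
    cheap: "\<And>j. cost (A j) (k j) < 1 / real (Suc j)" and
    bad: "\<And>j i. i < n j \<Longrightarrow> eps (A j) i * (real (A j ! i) - 1) \<noteq> 1"
    by (simp_all add: Q_def)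
  have k_lim: "filterlim (\<lambda>j. k j + c) at_top sequentially" for c
    by (rule filterlim_at_top_mono[OF filterlim_ident]) (intro always_eventually allI trans_le_add1 jk)
  note along = filterlim_compose[OF _ k_lim]
  have cost_lim: "(\<lambda>j. 1 / real (Suc j)) \<longlonglongrightarrow> 0"
    using LIMSEQ_inverse_real_of_nat by (simp add: inverse_eq_divide)
  have a_lim: "(\<lambda>j. real (A j ! (k j + c)) * D (k j + c)) \<longlonglongrightarrow> 1" if "c \<in> {0, 1, 2}" for c
  proof -
    have b: "0 \<le> t (A j) (k j + c) - 1 - ln (t (A j) (k j + c))"
      "t (A j) (k j + c) - 1 - ln (t (A j) (k j + c)) \<le> 1 / real (Suc j)" for j
      using cost_bounds(1)[OF max kn, of "k j + c" j] cheap[of j] that by auto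
    have "(\<lambda>j. t (A j) (k j + c) - 1 - ln (t (A j) (k j + c))) \<longlonglongrightarrow> 0"
      by (rule tendsto_sandwich[OF _ _ tendsto_const cost_lim]) (use b in auto)
    moreover have "0 < t (A j) (k j + c)" for j
      using that kn[of j] by (intro t_pos[OF max[of j]]) auto
    ultimately have "(\<lambda>j. t (A j) (k j + c)) \<longlonglongrightarrow> 1"
      by (rule tendsto_1_if_minus_ln_tendsto_0)
    then have "(\<lambda>j. t (A j) (k j + c) / (y (k j + c) / D (k j + c))) \<longlonglongrightarrow> 1 / 1"
      by (intro tendsto_divide along[OF y_quotient_tendsto_1]) auto
    moreover have "t (A j) (k j + c) / (y (k j + c) / D (k j + c)) = real (A j ! (k j + c)) * D (k j + c)" for j
      using y_pos[of "k j + c"] by (simp add: t_def)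
    ultimately show ?thesis by simp
  qed
  have eps_lim: "(\<lambda>j. eps (A j) (k j + c + 1) / D (k j + c + 1)) \<longlonglongrightarrow> 1"
    and eps_a_lim: "(\<lambda>j. (eps (A j) (k j + c + 1) - D (k j + c + 1)) * real (A j ! (k j + c))) \<longlonglongrightarrow> 0"
    if c: "c \<in> {0, 1}" for c
  proof -
    \<comment> \<open>\<open>r\<close> is the relative excess over the optimal remainder. With
      \<open>D'\<close> the optimal remainder at \<open>k j + c + 1\<close>, \<open>u\<close> is the
      entry at \<open>k j + c\<close> times \<open>D'\<close>, and \<open>v\<close> is the gap to
      the next entry times \<open>D'\<close>. As \<open>v\<close> tends to \<open>1\<close>,
      \<open>S = r * v\<close> forces \<open>r\<close> to \<open>0\<close>.\<close>
    define r where "r j = eps (A j) (k j + c + 1) / D (k j + c + 1) - 1" for j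
    define u where "u j = real (A j ! (k j + c)) * D (k j + c) * (D (Suc (k j + c)) / D (k j + c))" for j
    define v where "v j = real (A j ! (k j + (c + 1))) * D (k j + (c + 1)) - u j" for j
    have u: "u \<longlonglongrightarrow> 1 * 0"
      unfolding u_def using c by (intro tendsto_mult a_lim along[OF D_quotient_tendsto_0]) auto
    have v: "v \<longlonglongrightarrow> 1 - 1 * 0"
      unfolding v_def using c by (intro tendsto_diff a_lim u) auto
    have S: "S (A j) (k j + c) = r j * v j" for j
      using D_pos[of "k j + c"] D_pos[of "Suc (k j + c)"]
      by (simp add: S_def r_def v_def u_def field_simps)
    have b: "0 \<le> S (A j) (k j + c)" "S (A j) (k j + c) \<le> 1 / real (Suc j)" for j
      using cost_bounds(2)[OF max kn, of "k j + c" j] cheap[of j] c by auto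
    have "(\<lambda>j. S (A j) (k j + c)) \<longlonglongrightarrow> 0"
      by (rule tendsto_sandwich[OF _ _ tendsto_const cost_lim]) (use b in auto)
    then have "(\<lambda>j. r j * v j / v j) \<longlonglongrightarrow> 0 / (1 - 1 * 0)"
      unfolding S by (rule tendsto_divide[OF _ v]) simp
    moreover have "\<forall>\<^sub>F j in sequentially. 0 < v j" using order_tendstoD(1)[OF v, of 0] by simp
    then have "\<forall>\<^sub>F j in sequentially. r j * v j / v j = r j" by eventually_elim simp
    ultimately have r: "r \<longlonglongrightarrow> 0" using tendsto_cong by force
    have "(\<lambda>j. r j + 1) \<longlonglongrightarrow> 0 + 1" by (intro tendsto_add r tendsto_const)
    then show "(\<lambda>j. eps (A j) (k j + c + 1) / D (k j + c + 1)) \<longlonglongrightarrow> 1" by (simp add: r_def)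
    have "(\<lambda>j. r j * u j) \<longlonglongrightarrow> 0 * (1 * 0)" by (intro tendsto_mult r u)
    moreover have "r j * u j = (eps (A j) (k j + c + 1) - D (k j + c + 1)) * real (A j ! (k j + c))" for j
      using D_pos[of "k j + c"] D_pos[of "Suc (k j + c)"]
      by (simp add: r_def u_def field_simps)
    ultimately show "(\<lambda>j. (eps (A j) (k j + c + 1) - D (k j + c + 1)) * real (A j ! (k j + c))) \<longlonglongrightarrow> 0"
      by simp
  qed
  define N where "N c j = numer (A j) (k j + c)" for c j
  define r where "r j = N 2 j / N 1 j" for j
  have N_ge: "1 \<le> N c j" "N c j \<in> \<int>" if "c \<in> {1, 2}" for c j
    using that kn[of j] unfolding N_def by (auto intro!: numer_ge_1[OF max[of j]] numer_Ints[OF max[of j]])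
  have r_lim: "r \<longlonglongrightarrow> 1"
  proof -
    \<comment> \<open>The quotient of the numerators is the quotient of the remainders times the
      entry between them; it is split into factors that all tend to \<open>1\<close>.\<close>
    have "(\<lambda>j. (eps (A j) (k j + 1 + 1) / D (k j + 1 + 1)) / (eps (A j) (k j + 0 + 1) / D (k j + 0 + 1))
        * (D (Suc (k j + 1)) / (D (k j + 1))\<^sup>2) * (real (A j ! (k j + 1)) * D (k j + 1))) \<longlonglongrightarrow> 1 / 1 * 1 * 1"
      by (intro tendsto_mult tendsto_divide eps_lim a_lim along[OF D_square_quotient_tendsto_1]) auto
    moreover have "(eps (A j) (k j + 1 + 1) / D (k j + 1 + 1)) / (eps (A j) (k j + 0 + 1) / D (k j + 0 + 1))
        * (D (Suc (k j + 1)) / (D (k j + 1))\<^sup>2) * (real (A j ! (k j + 1)) * D (k j + 1)) = r j" for j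
    proof -
      define P where "P = (\<Prod>i<Suc (k j). real (A j ! i))"
      have "0 < P"
        unfolding P_def using kn[of j] max_nth_pos[OF max[of j]] by (intro prod_pos) auto
      moreover have "0 < eps (A j) (Suc (k j))" using kn[of j] by (intro eps_pos[OF max]) simp
      moreover have "N 1 j = eps (A j) (Suc (k j)) * (real q * P)"
        "N 2 j = eps (A j) (Suc (Suc (k j))) * (real q * (P * real (A j ! Suc (k j))))"
        unfolding N_def numer_def P_def by (simp_all add: numeral_2_eq_2)
      moreover have alg: "(e2 / d2) / (e1 / d1) * (d2 / d1\<^sup>2) * (a * d1) = (e2 * (c * (p * a))) / (e1 * (c * p))"
        if "e1 \<noteq> 0" "d1 \<noteq> 0" "d2 \<noteq> 0" "c \<noteq> 0" "p \<noteq> 0" for e1 e2 d1 d2 a c p :: real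
        using that by (simp add: power2_eq_square)
      note alg[of "eps (A j) (Suc (k j))" "D (Suc (k j))" "D (Suc (Suc (k j)))" "real q" P
          "eps (A j) (Suc (Suc (k j)))" "real (A j ! Suc (k j))"]
      ultimately show ?thesis
        using D_pos[of "Suc (k j)"] D_pos[of "Suc (Suc (k j))"] q_pos by (simp add: r_def)
    qed
    ultimately show ?thesis by simp
  qed
  obtain L where L: "E \<longlonglongrightarrow> L" "1 \<le> L" by (rule E_convergent)
  \<comment> \<open>A convergent upper bound for \<open>N 1\<close>, obtained from
    \<open>numer_eq\<close> by estimating the product of the \<open>t\<close> with
    \<open>prod_t_le\<close>.\<close>
  define B where "B j = eps (A j) (k j + 0 + 1) / D (k j + 0 + 1) * E (k j + 1)
      * exp ((eps (A j) (k j + 0 + 1) - D (k j + 0 + 1)) * real (A j ! (k j + 0)))" for j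
  have B_lim: "B \<longlonglongrightarrow> 1 * L * exp 0"
    unfolding B_def by (intro tendsto_mult tendsto_exp eps_lim eps_a_lim along[OF L(1)]) auto
  have N_le: "N 1 j \<le> B j" for j
  proof -
    have "0 \<le> eps (A j) (k j + 1) / D (k j + 1) * E (k j + 1)"
      using eps_pos[OF max[of j], of "k j + 1"] kn[of j] D_pos[of "k j + 1"] E_pos[of "k j + 1"] by simp
    moreover have "(\<Prod>i<k j + 1. t (A j) i)
        \<le> exp ((eps (A j) (k j + 0 + 1) - D (k j + 0 + 1)) * real (A j ! (k j + 0)))"
      using prod_t_le[OF max[of j], of "k j"] kn[of j] by simp
    ultimately show ?thesis
      unfolding N_def B_def numer_eq[OF max] add_0_right by (rule mult_left_mono[rotated])
  qed
  \<comment> \<open>A bounded numerator with quotient near \<open>1\<close> moves by less than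
    \<open>1\<close>, hence, being an integer, not at all.\<close>
  have "(\<lambda>j. B j * \<bar>r j - 1\<bar>) \<longlonglongrightarrow> (1 * L * exp 0) * \<bar>1 - 1\<bar>"
    by (intro tendsto_intros B_lim r_lim)
  then have "\<forall>\<^sub>F j in sequentially. B j * \<bar>r j - 1\<bar> < 1" by (intro order_tendstoD(2)) auto
  then obtain j where j: "B j * \<bar>r j - 1\<bar> < 1" by (auto simp: eventually_sequentially)
  have "N 2 j - N 1 j = N 1 j * (r j - 1)"
    using N_ge(1)[of 1 j] by (simp add: r_def field_simps)
  then have "\<bar>N 2 j - N 1 j\<bar> = N 1 j * \<bar>r j - 1\<bar>"
    using N_ge(1)[of 1 j] by (simp add: abs_mult)
  also have "\<dots> \<le> B j * \<bar>r j - 1\<bar>" by (intro mult_right_mono N_le) simp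
  also have "\<dots> < 1" by (rule j)
  finally have "N 2 j - N 1 j = 0" using N_ge(2)[of 1 j] N_ge(2)[of 2 j]
    by (metis Ints_diff Ints_nonzero_abs_less1 insertCI)
  then have same: "numer (A j) (Suc (k j + 1)) = numer (A j) (k j + 1)" by (simp add: N_def)
  have kn': "k j + 1 < n j" using kn[of j] by simp
  define P where "P = real q * (\<Prod>i<k j + 1. real (A j ! i))"
  have "0 < P"
    unfolding P_def using kn' max_nth_pos[OF max[of j]] q_pos by (intro mult_pos_pos prod_pos) auto
  moreover have "numer (A j) (k j + 1) = eps (A j) (k j + 1) * P" by (simp only: numer_def P_def)
  ultimately have "P * (eps (A j) (k j + 1) * (real (A j ! (k j + 1)) - 1)) = P * 1"
    using numer_Suc[OF max kn', folded P_def] same by (simp add: algebra_simps)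
  then have "eps (A j) (k j + 1) * (real (A j ! (k j + 1)) - 1) = 1"
    using \<open>0 < P\<close> by (simp only: mult_cancel_left) simp
  with bad[OF kn'] show False by blast
qed

text \<open>An optimal tuple of length \<open>n + 1\<close> has a unit fraction remainder
  \<open>1 / N\<close> at some \<open>k\<close>, so its tail must be the Sylvester continuation.
  Dropping the last entry leaves \<open>1 / M\<close>, and the greedy step inequality shows that
  nothing of length \<open>n\<close> does better.\<close>

lemma eventually_D_unit_fraction:
  "\<exists>n0\<ge>1. \<forall>n\<ge>n0. \<exists>M>0. D n = 1 / real M \<and> D (Suc n) = 1 / real (M * (M + 1)) \<and>
     (\<exists>bs. maximizing \<sigma> n l bs \<and> (\<forall>b\<in>set bs. \<sigma> b (M + 1)))"
proof -
  obtain n2 where n2: "\<And>n as. n2 \<le> n \<Longrightarrow> maximizing \<sigma> n l as \<Longrightarrow>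
      \<exists>k<n. eps as k * (real (as ! k) - 1) = 1"
    using eventually_unit_fraction_remainder by blast
  obtain n1 where n1: "\<And>n. n1 \<le> n \<Longrightarrow> D (Suc n) \<le> D n * y n"
    using eventually_greedy_step by (auto simp: eventually_sequentially)
  have "\<exists>M>0. D n = 1 / real M \<and> D (Suc n) = 1 / real (M * (M + 1)) \<and>
     (\<exists>bs. maximizing \<sigma> n l bs \<and> (\<forall>b\<in>set bs. \<sigma> b (M + 1)))" if "n1 \<le> n" "n2 \<le> n" for n
  proof -
    obtain as where max: "maximizing \<sigma> (Suc n) l as" using ex_maximizing[OF l_pos] by blast
    obtain k where k: "k < Suc n" "eps as k * (real (as ! k) - 1) = 1"
      using n2[OF _ max] \<open>n2 \<le> n\<close> by auto
    define N where "N = as ! k - 1"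
    define m where "m = n - k"
    have ak: "as ! k = N + 1" and N: "0 < N"
      using max_nth_ge_2[OF max k(1)] by (simp_all add: N_def)
    have eps_k: "eps as k = 1 / real N" using k(2) N unfolding ak by (simp add: field_simps)
    have nk: "Suc n = k + Suc m" using k(1) by (simp add: m_def)
    have dt: "as \<in> denom_tuples \<sigma> (Suc n)" using max_tuple(1)[OF max] .
    note dt' = denom_tuplesD[OF dt]
    have before: "\<sigma> a (as ! i)" if "a \<in> set (take i as)" "i \<le> n" for a i
      using that dt'(1,3) by (auto simp: in_set_conv_nth sorted_wrt_iff_nth_less)
    define g where "g = greedy \<sigma> (1 / real N) (Suc m)"
    have g_sum: "recip_sum g = 1 / real N - 1 / real (sylvester N (Suc m))"
      unfolding g_def greedy_eq_sylvester[OF N] by (rule recip_sum_sylvester[OF N])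
    \<comment> \<open>The first greedy denominator \<open>N + 1\<close> is \<open>as ! k\<close>
      itself, so the order at the junction is inherited from \<open>as\<close>.\<close>
    have "take k as @ g \<in> denom_tuples \<sigma> (k + Suc m)"
      unfolding g_def using before[of _ k] k(1) ak
      by (intro append_greedy_in_denom_tuples take_in_denom_tuples[OF max] N) auto
    moreover have tg_sum: "l - recip_sum (take k as @ g) = 1 / real (sylvester N (Suc m))"
      using eps_k g_sum by (simp add: eps_def)
    moreover have "0 < 1 / real (sylvester N (Suc m))" using sylvester_pos[OF N] by (simp del: sylvester.simps)
    ultimately have "admissible \<sigma> (Suc n) l (take k as @ g)"
      unfolding admissible_def nk by linarith
    then have "recip_sum (take k as @ g) \<le> recip_sum as" using max unfolding maximizing_iff by blast
    moreover have "recip_sum as = recip_sum (take k as) + recip_sum (drop k as)"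
      by (metis append_take_drop_id recip_sum_append)
    moreover have "recip_sum as < l" using max by (simp add: maximizing_iff admissible_def)
    ultimately have "recip_sum (drop k as) < 1 / real N"
      "1 / real N - 1 / real (sylvester N (Suc m)) \<le> recip_sum (drop k as)"
      unfolding g_sum[symmetric] using eps_k by (simp_all add: eps_def)
    moreover have "0 < a" if "a \<in> set (drop k as)" for a
      using dt'(2)[OF in_set_dropD[OF that]] by simp
    moreover have "sorted (drop k as)" "length (drop k as) = Suc m"
      using dt' nk by (simp_all add: sorted_wrt_drop)
    ultimately have "drop k as = g"
      unfolding g_def by (intro sylvester_le_imp_eq[OF N])
    then have as: "as = take k as @ map (\<lambda>i. sylvester N i + 1) [0..<Suc m]"
      unfolding g_def greedy_eq_sylvester[OF N] by (metis append_take_drop_id)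
    define M where "M = sylvester N m"
    have M: "0 < M" using N by (simp add: M_def)
    have len: "length (take k as) = k" using dt'(1) k(1) by simp
    have take_n: "take n as = take k as @ map (\<lambda>i. sylvester N i + 1) [0..<m]"
      by (subst as) (use k(1) len in \<open>simp add: m_def\<close>)
    have as_n: "as ! n = M + 1"
      by (subst as) (use k(1) len in \<open>simp add: m_def nth_append M_def\<close>)
    have eps_M: "eps as n = 1 / real M"
      using eps_k recip_sum_sylvester[OF N, of m] unfolding eps_def take_n by (simp add: M_def)
    have D_Suc: "D (Suc n) = 1 / real (M * (M + 1))"
    proof -
      have "D (Suc n) = eps as n - 1 / real (as ! n)"
        using eps_Suc[OF max, of n] eps_n[OF max] by simp
      also have "\<dots> = 1 / real (M * (M + 1))"
        unfolding eps_M as_n using M by (simp add: field_simps)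
      finally show ?thesis .
    qed
    have "D n = 1 / real M"
    proof (rule antisym)
      show "D n \<le> 1 / real M" using D_le_eps[OF max, of n] eps_M by simp
      have scale: "1 + x \<le> x * x * c" if "1 / c \<le> x * (x - 1 / c)" "0 < c" for c x :: real
        using that by (simp add: field_simps)
      have "1 / real (M * (M + 1)) \<le> D n * (D n - 1 / real (M * (M + 1)))"
        using n1[OF that(1)] unfolding y_def D_Suc .
      moreover have "0 < real (M * (M + 1))" using M by (simp only: of_nat_0_less_iff) simp
      ultimately have "1 + D n \<le> D n * D n * real (M * (M + 1))" by (rule scale)
      \<comment> \<open>The quadratic inequality for \<open>D n\<close> factors with one positive
        factor, leaving \<open>D n \<ge> 1 / M\<close>.\<close>
      then have "0 \<le> (real M * D n - 1) * ((real M + 1) * D n + 1)" by (simp add: algebra_simps)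
      moreover have "0 < (real M + 1) * D n + 1" using D_pos[of n] by (intro add_nonneg_pos mult_nonneg_nonneg) auto
      ultimately have "0 \<le> real M * D n - 1" by (simp add: zero_le_mult_iff)
      then show "1 / real M \<le> D n" using M by (simp add: field_simps)
    qed
    moreover from this have "maximizing \<sigma> n l (take n as)"
      using take_in_denom_tuples[OF max, of n] eps_M by (simp add: maximizing_iff_D eps_def)
    moreover have "\<sigma> b (M + 1)" if "b \<in> set (take n as)" for b
      using before[OF that] as_n by simp
    ultimately show ?thesis using M D_Suc by blast
  qed
  then show ?thesis by (intro exI[of _ "max 1 (max n1 n2)"]) auto
qed

end

section \<open>Greedy continuation from a unit fraction remainder\<close>

theorem theorem1:
  fixes \<sigma> :: "nat \<Rightarrow> nat \<Rightarrow> bool" and l :: real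
  assumes "\<sigma> = (\<le>) \<or> \<sigma> = (<)"
    and "l \<in> \<rat>" and "l > 0"
  shows "\<exists>n0\<ge>1.
    (\<forall>m\<ge>1. R \<sigma> (n0 + m) l = R \<sigma> n0 l + R \<sigma> m (l - R \<sigma> n0 l) \<and>
       maximizing \<sigma> m (l - R \<sigma> n0 l) (greedy \<sigma> (l - R \<sigma> n0 l) m) \<and>
       (\<forall>bs. maximizing \<sigma> m (l - R \<sigma> n0 l) bs \<longrightarrow> bs = greedy \<sigma> (l - R \<sigma> n0 l) m)) \<and>
    (\<exists>as. maximizing \<sigma> n0 l as \<and>
       (\<forall>m\<ge>1. maximizing \<sigma> (n0 + m) l (as @ greedy \<sigma> (l - R \<sigma> n0 l) m)))"
proof -
  obtain q where "0 < q" "real q * l \<in> \<int>"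
  proof -
    obtain m n where "n \<noteq> 0" "\<bar>l\<bar> = real m / real n" using Rats_abs_nat_div_natE[OF assms(2)] by metis
    then have "real n * l = real m" using assms(3) by simp
    then show thesis using that[of n] \<open>n \<noteq> 0\<close> by simp
  qed
  then interpret rational_underapproximation \<sigma> l q
    using assms by unfold_locales auto
  obtain n0 where "1 \<le> n0" and unit: "\<And>n. n0 \<le> n \<Longrightarrow> \<exists>M>0. D n = 1 / real M \<and>
      D (Suc n) = 1 / real (M * (M + 1)) \<and> (\<exists>bs. maximizing \<sigma> n l bs \<and> (\<forall>b\<in>set bs. \<sigma> b (M + 1)))"
    using eventually_D_unit_fraction by blast
  obtain N as where N: "0 < N" "D n0 = 1 / real N"
    and as: "maximizing \<sigma> n0 l as" "\<And>a. a \<in> set as \<Longrightarrow> \<sigma> a (N + 1)"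
    using unit[of n0] by auto
  \<comment> \<open>Each \<open>M\<close> is determined by its remainder, so the passage from
    \<open>M\<close> to \<open>M * (M + 1)\<close> reproduces the recursion of
    \<open>sylvester N\<close>.\<close>
  have D: "D (n0 + m) = 1 / real (sylvester N m)" for m
  proof (induction m)
    case (Suc m)
    obtain M where "D (n0 + m) = 1 / real M" "D (Suc (n0 + m)) = 1 / real (M * (M + 1))"
      using unit[of "n0 + m"] by auto
    with Suc have "real M = real (sylvester N m)" "D (Suc (n0 + m)) = 1 / real (M * (M + 1))" by simp_all
    then show ?case by simp
  qed (simp add: N)
  have R0: "l - R \<sigma> n0 l = 1 / real N" using N by (simp add: D_def)
  have "R \<sigma> (n0 + m) l = R \<sigma> n0 l + R \<sigma> m (1 / real N)" for m
    using D[of m] R0 greedy_unique_maximizing(3)[OF N(1), of m] by (simp add: D_def)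
  moreover have "maximizing \<sigma> (n0 + m) l (as @ greedy \<sigma> (1 / real N) m)" for m
  proof -
    have "l - recip_sum as = 1 / real N" "as \<in> denom_tuples \<sigma> n0"
      using as(1) N(2) by (simp_all add: maximizing_iff_D)
    moreover from this(2) have "as @ greedy \<sigma> (1 / real N) m \<in> denom_tuples \<sigma> (n0 + m)"
      using N(1) as(2) by (rule append_greedy_in_denom_tuples)
    ultimately show ?thesis
      using D[of m] recip_sum_sylvester[OF N(1), of m] greedy_eq_sylvester[OF N(1), of m]
      by (simp add: maximizing_iff_D)
  qed
  ultimately show ?thesis
    unfolding R0[symmetric]
    by (intro exI[of _ n0] exI[of _ as] conjI allI impI \<open>1 \<le> n0\<close> as(1)
        greedy_unique_maximizing(1,2)[OF N(1), folded R0])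
qed

end
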